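(* In the setting described in the context (spaces $V\hookrightarrow H\hookrightarrow V'$, $\alpha\in[0,1[$, damping $\gamma$, operator $A$, nonlinearity $f=\nabla F$, convex function $\Phi$ with $\arg\min\Phi\neq\emptyset$, and source $g\in L^1(\mathbb{R}^+,H)$), assume that $$\int_0^{+\infty}(1+t)^{\alpha}|g(t)|\,dt<\infty .$$ Let $u\in W^{2,1}_{loc}(\mathbb{R}^+,H)\cap W^{1,1}_{loc}(\mathbb{R}^+,V)$ be a solution of $$u''(t)+\gamma(t)u'(t)+Au(t)+f(u(t))=g(t),\quad t\ge 0.$$ If $u\in L^\infty(\mathbb{R}^+,H)$, then $u(t)$ converges weakly in $V$ as $t\to+\infty$ toward some element of $\arg\min\Phi$. Moreover, the energy function $$\mathcal{E}(t):=\tfrac12|u'(t)|^2+\Phi(u(t))-\Phi^*$$ satisfies $\mathcal{E}(t)=o(t^{-2\alpha})$ as $t\to+\infty$.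
   Context: Setting. $\mathbb{R}^+=[0,+\infty)$. $H$ is a real Hilbert space with inner product $\langle\cdot,\cdot\rangle$ and norm $|\cdot|$. $V$ is another Hilbert space, with norm $\|\cdot\|_V$, continuously and densely embedded in $H$; $V'$ is the dual of $V$. Identifying $H$ with its dual, $V\hookrightarrow H\hookrightarrow V'$, and $\langle v,w\rangle_{V',V}=\langle v,w\rangle$ for all $(v,w)\in H\times V$. Damping: $\alpha\in[0,1[$, and $\gamma\in W^{1,1}_{loc}(\mathbb{R}^+,\mathbb{R}^+)$ is such that there exist $K>0$ and $t_0\ge0$ with $\gamma(t)\ge \frac{K}{(1+t)^\alpha}$ for all $t\ge t_0$, and $\big((1+t)^\alpha\gamma(t)\big)'\le 0$ for a.e. $t\ge t_0$. Operator: $A:V\to V'$ is linear and continuous; the bilinear form $a(v,w)=\langle Av,w\rangle_{V',V}$ on $V\times V$ is symmetric, positive ($a(v,v)\ge0$ for all $v\in V$), and there exist $\lambda\ge0$, $\mu>0$ with $a(v,v)+\lambda|v|^2\ge\mu\|v\|_V^2$ for all $v\in V$. Nonlinearity: $f:V\to V'$ is continuous and there is a $C^1$ convex function $F:V\to\mathbb{R}$ with $F'(u)(v)=\langle f(u),v\rangle_{V',V}$ for all $u,v\in V$. Potential: $\Phi:V\to\mathbb{R}$, $\Phi(v)=\frac12 a(v,v)+F(v)$; it is a $C^1$ convex function with $\nabla\Phi(v)=Av+f(v)$. The set $\arg\min\Phi=\{v\in V:\Phi(v)=\min_V\Phi\}=\{v\in V: Av+f(v)=0\}$ is assumed nonempty,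 and $\Phi^*:=\min_V\Phi$. Source: $g\in L^1(\mathbb{R}^+,H)$. The equation is understood to hold for almost every $t\ge0$. *)

theory Defs
  imports "HOL-Analysis.Analysis" "HOL-Library.Landau_Symbols"
begin

section \<open>Bochner integral without separability\<close>

text \<open>
  The library's \<open>has_bochner_integral\<close> requires a second countable target space, whereas the
  Hilbert spaces considered here need not be separable.  The definition below is the library's with
  Borel measurability replaced by strong measurability (a.e. limit of simple functions); lemma
  \<open>has_strong_integral_iff_has_bochner_integral\<close> shows that they agree whenever both make sense.
\<close>

definition strongly_measurable :: "'a measure \<Rightarrow> ('a \<Rightarrow> 'b::real_normed_vector) \<Rightarrow> bool" where
  "strongly_measurable M f \<longleftrightarrow>
     (\<exists>s. (\<forall>i. simple_function M (s i)) \<and> (AE x in M. (\<lambda>i::nat. s i x) \<longlonglongrightarrow> f x))"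

definition has_strong_integral :: "'a measure \<Rightarrow> ('a \<Rightarrow> 'b::real_normed_vector) \<Rightarrow> 'b \<Rightarrow> bool" where
  "has_strong_integral M f I \<longleftrightarrow> strongly_measurable M f \<and>
     (\<exists>s. (\<forall>i::nat. Bochner_Integration.simple_bochner_integrable M (s i)) \<and>
          (\<lambda>i. \<integral>\<^sup>+x. norm (f x - s i x) \<partial>M) \<longlonglongrightarrow> 0 \<and>
          (\<lambda>i. Bochner_Integration.simple_bochner_integral M (s i)) \<longlonglongrightarrow> I)"

lemma has_strong_integral_iff_has_bochner_integral:
  fixes f :: "'a::euclidean_space \<Rightarrow> 'b::{real_normed_vector, second_countable_topology}"
  shows "has_strong_integral lebesgue f I \<longleftrightarrow> has_bochner_integral lebesgue f I"
proof
  assume "has_strong_integral lebesgue f I"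
  then obtain s s' where s: "\<And>i. simple_function lebesgue (s i)"
      "AE x in lebesgue. (\<lambda>i::nat. s i x) \<longlonglongrightarrow> f x"
    and s': "\<And>i::nat. Bochner_Integration.simple_bochner_integrable lebesgue (s' i)"
      "(\<lambda>i. \<integral>\<^sup>+x. norm (f x - s' i x) \<partial>lebesgue) \<longlonglongrightarrow> 0"
      "(\<lambda>i. Bochner_Integration.simple_bochner_integral lebesgue (s' i)) \<longlonglongrightarrow> I"
    unfolding has_strong_integral_def strongly_measurable_def by auto
  obtain N where N: "N \<in> null_sets lebesgue" "\<And>x. x \<notin> N \<Longrightarrow> (\<lambda>i. s i x) \<longlonglongrightarrow> f x"
    using s(2) by (auto elim!: AE_E3)
  have negl: "negligible N"
    using N(1) by (simp add: negligible_iff_null_sets)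
  have "s i \<in> borel_measurable (lebesgue_on (- N))" for i
    using borel_measurable_simple_function[OF s(1)] measurable_restrict_space1 by blast
  then have "f \<in> borel_measurable (lebesgue_on (- N))"
    by (rule borel_measurable_LIMSEQ_metric) (use N in \<open>auto simp: space_restrict_space\<close>)
  then have "f \<in> borel_measurable lebesgue"
    unfolding measurable_def
  proof (safe, goal_cases)
    case (2 B)
    then have 1: "f -` B \<inter> (- N) \<in> sets (lebesgue_on (- N))"
      by (auto simp: space_restrict_space)
    have "- N \<in> sets lebesgue"
      using N(1) by (auto simp: Compl_in_sets_lebesgue)
    then have "f -` B \<inter> (- N) \<in> sets lebesgue"
      using 1 by (simp add: sets_restrict_space_iff)
    moreover have "f -` B \<inter> N \<in> sets lebesgue"
      using negl negligible_subset negligible_imp_sets by (metis inf_le2)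
    ultimately have "(f -` B \<inter> (- N)) \<union> (f -` B \<inter> N) \<in> sets lebesgue"
      by (rule sets.Un)
    then show ?case
      by (simp add: Int_Un_distrib[symmetric])
  qed auto
  then show "has_bochner_integral lebesgue f I"
    by (rule has_bochner_integral.intros) (use s' in auto)
next
  assume "has_bochner_integral lebesgue f I"
  then show "has_strong_integral lebesgue f I"
  proof cases
    case (1 s)
    obtain F where "\<And>i. simple_function lebesgue (F i)" "\<And>x. (\<lambda>i. F i x) \<longlonglongrightarrow> f x"
      using borel_measurable_implies_sequence_metric[OF 1(1), of 0] by auto
    then have "strongly_measurable lebesgue f"
      unfolding strongly_measurable_def by auto
    then show ?thesis
      unfolding has_strong_integral_def using 1 by auto
  qed
qed

definition has_strong_integral_on ::
    "(real \<Rightarrow> 'b::real_normed_vector) \<Rightarrow> 'b \<Rightarrow> real set \<Rightarrow> bool" where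
  "has_strong_integral_on f I S \<longleftrightarrow> has_strong_integral lebesgue (\<lambda>t. indicator S t *\<^sub>R f t) I"

definition L1_on :: "real set \<Rightarrow> (real \<Rightarrow> 'b::real_normed_vector) \<Rightarrow> bool" where
  "L1_on S f \<longleftrightarrow> (\<exists>I. has_strong_integral_on f I S)"


section \<open>Sobolev functions on the half-line\<close>

text \<open>
  \<open>W11_loc_deriv u v\<close> says that \<open>u\<close> belongs to $W^{1,1}_{loc}([0,\infty), X)$ with weak derivative
  \<open>v\<close>: \<open>v\<close> is Bochner integrable on every \<open>{0..t}\<close> and \<open>u t = u 0 + \<integral>\<^sub>0\<^sup>t v\<close>.  An element
  of the space is thus represented by its continuous representative, so that \<open>u t\<close> is meaningful for
  every \<open>t \<ge> 0\<close>, while \<open>v\<close> is determined up to null sets only.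
  Then \<open>u\<close> is in $W^{2,1}_{loc}$ iff \<open>W11_loc_deriv u v\<close> and \<open>W11_loc_deriv v w\<close> for some \<open>v\<close> and
  \<open>w\<close>; here \<open>v\<close> is the continuous representative of the first derivative.
\<close>

definition W11_loc_deriv :: "(real \<Rightarrow> 'b::real_normed_vector) \<Rightarrow> (real \<Rightarrow> 'b) \<Rightarrow> bool" where
  "W11_loc_deriv u v \<longleftrightarrow> (\<forall>t\<ge>0. has_strong_integral_on v (u t - u 0) {0..t})"

definition W11_loc :: "(real \<Rightarrow> 'b::real_normed_vector) \<Rightarrow> bool" where
  "W11_loc u \<longleftrightarrow> (\<exists>v. W11_loc_deriv u v)"


section \<open>The Gelfand triple and the energy\<close>

text \<open>The inclusion of \<open>V\<close> in \<open>H\<close> is an explicit map \<open>\<iota>\<close>, and the dual of \<open>V\<close> is \<open>'v \<Rightarrow>\<^sub>L real\<close>.\<close>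

definition dense_embedding :: "('v::real_normed_vector \<Rightarrow> 'h::real_normed_vector) \<Rightarrow> bool" where
  "dense_embedding \<iota> \<longleftrightarrow> bounded_linear \<iota> \<and> inj \<iota> \<and> closure (range \<iota>) = UNIV"

text \<open>The inclusion of \<open>H\<close> in \<open>V'\<close> obtained by identifying \<open>H\<close> with its own dual.\<close>

definition to_dual :: "('v::real_normed_vector \<Rightarrow> 'h::real_inner) \<Rightarrow> 'h \<Rightarrow> 'v \<Rightarrow>\<^sub>L real" where
  "to_dual \<iota> h = Blinfun (\<lambda>v. h \<bullet> \<iota> v)"

lemma to_dual_apply:
  assumes "dense_embedding \<iota>"
  shows "blinfun_apply (to_dual \<iota> h) v = h \<bullet> \<iota> v"
  using assms unfolding to_dual_def dense_embedding_def
  by (subst bounded_linear_Blinfun_apply) (auto intro: bounded_linear_inner_right_comp)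

definition potential ::
    "('v::real_normed_vector \<Rightarrow> 'v \<Rightarrow>\<^sub>L real) \<Rightarrow> ('v \<Rightarrow> real) \<Rightarrow> 'v \<Rightarrow> real" where
  "potential A F v = 1/2 * blinfun_apply (A v) v + F v"

definition argmin :: "('v \<Rightarrow> real) \<Rightarrow> 'v set" where
  "argmin \<Phi> = {v. is_arg_min \<Phi> (\<lambda>_. True) v}"

text \<open>The infimum below is attained, hence a minimum, whenever \<open>argmin \<Phi>\<close> is nonempty.\<close>

definition energy ::
    "('v \<Rightarrow> real) \<Rightarrow> (real \<Rightarrow> 'v) \<Rightarrow> (real \<Rightarrow> 'h::real_normed_vector) \<Rightarrow> real \<Rightarrow> real" where
  "energy \<Phi> u u' t = 1/2 * (norm (u' t))\<^sup>2 + \<Phi> (u t) - (INF v. \<Phi> v)"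

definition weakly_tendsto ::
    "('a \<Rightarrow> 'v::real_normed_vector) \<Rightarrow> 'v \<Rightarrow> 'a filter \<Rightarrow> bool" where
  "weakly_tendsto x l \<F> \<longleftrightarrow>
     (\<forall>\<phi> :: 'v \<Rightarrow>\<^sub>L real. ((\<lambda>t. blinfun_apply \<phi> (x t)) \<longlongrightarrow> blinfun_apply \<phi> l) \<F>)"

end

(*
  With h(t) = (1 + t)^alpha, v = |u'|, Y = h^2 E and phi = |u - x|^2 / 2 for a minimiser x, the
  energy identity gives Y' <= 2 h' (h E) - K h v^2 + (h |g|) (h v), where h' tends to 0 because
  alpha < 1.  Multiplying phi'' + gamma phi' <= 3/2 v^2 - E + |g| |u - x| by h and using that
  p = h gamma is nonincreasing and h'' <= 0 gives Z' <= 3/2 h v^2 - h E + integrable terms for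
  Z = h phi' + p phi - h' phi, and |Z| is bounded by a multiple of 1 + sqrt Y.  Evaluating the
  two inequalities at a maximum point of Y bounds Y and the integrals of h E and h v^2.  Then Y
  has a limit, which is 0 because Y / h is integrable and 1 / h is not; this is the decay of E.
  Likewise Z, hence p phi, hence phi converges, since p >= K.  By convexity weak cluster points
  of u are minimisers, so Opial's argument gives weak convergence.
*)
theory Submission
  imports Defs
begin

subsection \<open>Strong integrals\<close>

text \<open>The two inequalities form a loop: the first contains h E with the wrong sign, which only
  the second controls, and the second contains h v^2 with the wrong sign, which only the damping in
  the first controls. The loop closes because a round trip is cheap. Once 2 h' <= K/3, the integral
  of h E enters with factor K/3 and is replaced by 3/2 of the integral of h v^2, so it costs K/2 of
  the available K. What remains, namely the source and the boundary values of Z, grows at most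
  linearly in the square root of the maximum of Y and cannot compete with Y itself. Two features of
  the setting shape the form of the proof. Derivatives exist only as locally integrable functions,
  so each differential inequality is stated as a bound for increments by an integral. The spaces may
  be non-separable, so vector-valued maps are accessed through approximating simple functions, and
  weak compactness is expressed by filters in place of sequences.\<close>

lemma borel_measurable_AE_limit:
  fixes f :: "'a::euclidean_space \<Rightarrow> 'b::euclidean_space"
  assumes "\<And>i::nat. s i \<in> borel_measurable lebesgue"
    and "AE x in lebesgue. (\<lambda>i. s i x) \<longlonglongrightarrow> f x"
  shows "f \<in> borel_measurable lebesgue"
proof -
  obtain N where N: "N \<in> null_sets lebesgue" "\<And>x. x \<notin> N \<Longrightarrow> (\<lambda>i. s i x) \<longlonglongrightarrow> f x"
    using assms(2) by (auto elim!: AE_E3)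
  have "(\<lambda>x. indicator (- N) x *\<^sub>R f x) \<in> borel_measurable lebesgue"
  proof (rule borel_measurable_LIMSEQ_metric)
    have "- N \<in> sets lebesgue"
      using N(1) by (auto simp: Compl_in_sets_lebesgue)
    then show "(\<lambda>x. indicator (- N) x *\<^sub>R s i x) \<in> borel_measurable lebesgue" for i
      using assms(1)[of i] by measurable
    show "(\<lambda>i. indicator (- N) x *\<^sub>R s i x) \<longlonglongrightarrow> indicator (- N) x *\<^sub>R f x" for x
      by (cases "x \<in> N") (auto intro: N)
  qed
  moreover have "AE x in lebesgue. indicator (- N) x *\<^sub>R f x = f x"
    using AE_not_in[OF N(1)] by eventually_elim auto
  ultimately show ?thesis
    by (rule borel_measurable_AE)
qed

text \<open>Superposition with a Caratheodory function. For a simple approximant the preimage splits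
  into finitely many pieces, on each of which only measurability in \<open>t\<close> matters;
  continuity in \<open>y\<close> carries the property to the limit. This yields measurable scalar
  functions of \<open>f\<close> although its target may be non-separable.\<close>

lemma strongly_measurable_superposition:
  fixes f :: "'a::euclidean_space \<Rightarrow> 'b::real_normed_vector" and c :: "'a \<Rightarrow> 'b \<Rightarrow> real"
  assumes f: "strongly_measurable lebesgue f"
    and c: "\<And>y. (\<lambda>t. c t y) \<in> borel_measurable lebesgue" "\<And>t. continuous_on UNIV (c t)"
  shows "(\<lambda>t. c t (f t)) \<in> borel_measurable lebesgue"
proof -
  obtain s where s: "\<And>i. simple_function lebesgue (s i)"
    and lim: "AE x in lebesgue. (\<lambda>i::nat. s i x) \<longlonglongrightarrow> f x"
    using f by (auto simp: strongly_measurable_def)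
  show ?thesis
  proof (rule borel_measurable_AE_limit)
    show "(\<lambda>t. c t (s i t)) \<in> borel_measurable lebesgue" for i
    proof (rule measurableI)
      fix B :: "real set" assume B: "B \<in> sets borel"
      have "(\<lambda>t. c t (s i t)) -` B \<inter> space lebesgue =
            (\<Union>y\<in>s i ` space lebesgue. (s i -` {y} \<inter> space lebesgue) \<inter> ((\<lambda>t. c t y) -` B \<inter> space lebesgue))"
        by auto
      also have "\<dots> \<in> sets lebesgue"
        using s[of i] measurable_sets[OF c(1) B]
        by (intro sets.finite_UN sets.Int) (auto simp: simple_function_def)
      finally show "(\<lambda>t. c t (s i t)) -` B \<inter> space lebesgue \<in> sets lebesgue" .
    qed auto
    show "AE t in lebesgue. (\<lambda>i. c t (s i t)) \<longlonglongrightarrow> c t (f t)"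
      using lim
    proof eventually_elim
      case (elim t)
      then show ?case
        using c(2)[of t] by (metis UNIV_I continuous_on_eq_continuous_at isCont_tendsto_compose open_UNIV)
    qed
  qed
qed

lemma strongly_measurable_norm_diff:
  fixes f :: "'a::euclidean_space \<Rightarrow> 'b::real_normed_vector"
  assumes "strongly_measurable lebesgue f" "simple_function lebesgue s"
  shows "(\<lambda>t. norm (f t - s t)) \<in> borel_measurable lebesgue"
proof (rule strongly_measurable_superposition[OF assms(1)])
  have "simple_function lebesgue (\<lambda>t. norm (y - s t))" for y
    using assms(2) by (rule simple_function_compose1)
  then show "(\<lambda>t. norm (y - s t)) \<in> borel_measurable lebesgue" for y
    by (rule borel_measurable_simple_function)
qed (intro continuous_intros)

lemma strongly_measurable_compose2:
  assumes "strongly_measurable M f" "strongly_measurable M g"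
    and "continuous_on UNIV (\<lambda>z. p (fst z) (snd z))"
  shows "strongly_measurable M (\<lambda>t. p (f t) (g t))"
proof -
  obtain s where s: "\<And>i. simple_function M (s i)" "AE x in M. (\<lambda>i::nat. s i x) \<longlonglongrightarrow> f x"
    using assms(1) by (auto simp: strongly_measurable_def)
  obtain r where r: "\<And>i. simple_function M (r i)" "AE x in M. (\<lambda>i::nat. r i x) \<longlonglongrightarrow> g x"
    using assms(2) by (auto simp: strongly_measurable_def)
  have "AE x in M. (\<lambda>i. p (s i x) (r i x)) \<longlonglongrightarrow> p (f x) (g x)"
    using s(2) r(2)
  proof eventually_elim
    case (elim x)
    have "isCont (\<lambda>z. p (fst z) (snd z)) (f x, g x)"
      using assms(3) by (simp add: continuous_on_eq_continuous_at)
    from isCont_tendsto_compose[OF this tendsto_Pair[OF elim]] show ?case by simp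
  qed
  moreover have "simple_function M (\<lambda>x. p (s i x) (r i x))" for i
    using s(1)[of i] r(1)[of i] by (rule simple_function_compose2)
  ultimately show ?thesis
    unfolding strongly_measurable_def by (intro exI[of _ "\<lambda>i x. p (s i x) (r i x)"]) auto
qed

lemma has_strong_integral_bounded_linear:
  fixes f :: "'a::euclidean_space \<Rightarrow> 'b::real_normed_vector" and T :: "'b \<Rightarrow> 'c::real_normed_vector"
  assumes T: "bounded_linear T" and f: "has_strong_integral lebesgue f I"
  shows "has_strong_integral lebesgue (\<lambda>t. T (f t)) (T I)"
proof -
  interpret T: bounded_linear T by fact
  obtain s where meas: "strongly_measurable lebesgue f"
    and s: "\<And>i::nat. Bochner_Integration.simple_bochner_integrable lebesgue (s i)"
      "(\<lambda>i. \<integral>\<^sup>+x. norm (f x - s i x) \<partial>lebesgue) \<longlonglongrightarrow> 0"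
      "(\<lambda>i. Bochner_Integration.simple_bochner_integral lebesgue (s i)) \<longlonglongrightarrow> I"
    using f by (auto simp: has_strong_integral_def)
  have sf: "simple_function lebesgue (s i)" for i
    using s(1)[of i] by (auto elim: Bochner_Integration.simple_bochner_integrable.cases)
  obtain K where K: "K > 0" "\<And>x. norm (T x) \<le> norm x * K"
    using T.pos_bounded by auto
  have "(\<lambda>i. \<integral>\<^sup>+x. norm (T (f x) - T (s i x)) \<partial>lebesgue) \<longlonglongrightarrow> 0"
  proof (rule tendsto_sandwich)
    show "eventually (\<lambda>i. 0 \<le> (\<integral>\<^sup>+x. norm (T (f x) - T (s i x)) \<partial>lebesgue)) sequentially" "(\<lambda>_. 0::ennreal) \<longlonglongrightarrow> 0"
      by auto
    show "eventually (\<lambda>i. (\<integral>\<^sup>+x. norm (T (f x) - T (s i x)) \<partial>lebesgue) \<le> K * (\<integral>\<^sup>+x. norm (f x - s i x) \<partial>lebesgue)) sequentially"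
    proof (intro always_eventually allI)
      fix i
      have "(\<integral>\<^sup>+x. norm (T (f x) - T (s i x)) \<partial>lebesgue) \<le> (\<integral>\<^sup>+x. ennreal K * norm (f x - s i x) \<partial>lebesgue)"
        using K by (intro nn_integral_mono) (auto simp: ac_simps ennreal_mult[symmetric] T.diff[symmetric])
      also have "\<dots> = K * (\<integral>\<^sup>+x. norm (f x - s i x) \<partial>lebesgue)"
        using strongly_measurable_norm_diff[OF meas sf] by (intro nn_integral_cmult) auto
      finally show "(\<integral>\<^sup>+x. norm (T (f x) - T (s i x)) \<partial>lebesgue) \<le> K * (\<integral>\<^sup>+x. norm (f x - s i x) \<partial>lebesgue)" .
    qed
    show "(\<lambda>i. K * (\<integral>\<^sup>+x. norm (f x - s i x) \<partial>lebesgue)) \<longlonglongrightarrow> 0"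
      using ennreal_tendsto_cmult[OF _ s(2)] by simp
  qed
  moreover have "(\<lambda>i. Bochner_Integration.simple_bochner_integral lebesgue (\<lambda>x. T (s i x))) \<longlonglongrightarrow> T I"
    using T.tendsto[OF s(3)] by (simp add: simple_bochner_integral_linear[OF T.linear_axioms s(1)])
  moreover have "Bochner_Integration.simple_bochner_integrable lebesgue (\<lambda>x. T (s i x))" for i
    using s(1)[of i] by (auto intro: simple_bochner_integrable_compose2 T.zero)
  moreover have "strongly_measurable lebesgue (\<lambda>t. T (f t))"
    using meas meas
    by (rule strongly_measurable_compose2) (intro T.continuous_on continuous_on_fst continuous_on_id)
  ultimately show ?thesis
    unfolding has_strong_integral_def by (auto intro!: exI[of _ "\<lambda>i x. T (s i x)"])
qed

lemma has_strong_integral_add: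
  fixes f g :: "'a::euclidean_space \<Rightarrow> 'b::real_normed_vector"
  assumes "has_strong_integral lebesgue f I" "has_strong_integral lebesgue g J"
  shows "has_strong_integral lebesgue (\<lambda>t. f t + g t) (I + J)"
proof -
  obtain s where meas: "strongly_measurable lebesgue f"
    and s: "\<And>i::nat. Bochner_Integration.simple_bochner_integrable lebesgue (s i)"
      "(\<lambda>i. \<integral>\<^sup>+x. norm (f x - s i x) \<partial>lebesgue) \<longlonglongrightarrow> 0"
      "(\<lambda>i. Bochner_Integration.simple_bochner_integral lebesgue (s i)) \<longlonglongrightarrow> I"
    using assms(1) by (auto simp: has_strong_integral_def)
  obtain r where meas': "strongly_measurable lebesgue g"
    and r: "\<And>i::nat. Bochner_Integration.simple_bochner_integrable lebesgue (r i)"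
      "(\<lambda>i. \<integral>\<^sup>+x. norm (g x - r i x) \<partial>lebesgue) \<longlonglongrightarrow> 0"
      "(\<lambda>i. Bochner_Integration.simple_bochner_integral lebesgue (r i)) \<longlonglongrightarrow> J"
    using assms(2) by (auto simp: has_strong_integral_def)
  have sf: "simple_function lebesgue (s i)" "simple_function lebesgue (r i)" for i
    using s(1)[of i] r(1)[of i] by (auto elim: Bochner_Integration.simple_bochner_integrable.cases)
  have "(\<lambda>i. \<integral>\<^sup>+x. norm (f x + g x - (s i x + r i x)) \<partial>lebesgue) \<longlonglongrightarrow> 0" (is "?f \<longlonglongrightarrow> 0")
  proof (rule tendsto_sandwich)
    show "eventually (\<lambda>n. 0 \<le> ?f n) sequentially" "(\<lambda>_. 0::ennreal) \<longlonglongrightarrow> 0"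
      by auto
    show "eventually (\<lambda>i. ?f i \<le> (\<integral>\<^sup>+x. norm (f x - s i x) \<partial>lebesgue) + (\<integral>\<^sup>+x. norm (g x - r i x) \<partial>lebesgue)) sequentially"
      (is "eventually (\<lambda>i. ?f i \<le> ?g i) sequentially")
    proof (intro always_eventually allI)
      fix i have "?f i \<le> (\<integral>\<^sup>+x. (norm (f x - s i x)) + ennreal (norm (g x - r i x)) \<partial>lebesgue)"
        by (auto intro!: nn_integral_mono norm_diff_triangle_ineq simp flip: ennreal_plus)
      also have "\<dots> = ?g i"
        using strongly_measurable_norm_diff[OF meas sf(1)] strongly_measurable_norm_diff[OF meas' sf(2)]
        by (intro nn_integral_add) auto
      finally show "?f i \<le> ?g i" .
    qed
    show "?g \<longlonglongrightarrow> 0"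
      using tendsto_add[OF s(2) r(2)] by simp
  qed
  moreover have "(\<lambda>i. Bochner_Integration.simple_bochner_integral lebesgue (\<lambda>x. s i x + r i x)) \<longlonglongrightarrow> I + J"
    using tendsto_add[OF s(3) r(3)] by (simp add: simple_bochner_integral_add s(1) r(1))
  moreover have "Bochner_Integration.simple_bochner_integrable lebesgue (\<lambda>x. s i x + r i x)" for i
    using s(1)[of i] r(1)[of i] by (auto intro: simple_bochner_integrable_compose2)
  moreover have "strongly_measurable lebesgue (\<lambda>t. f t + g t)"
    using meas meas' by (rule strongly_measurable_compose2) (intro continuous_intros)
  ultimately show ?thesis
    unfolding has_strong_integral_def by (auto intro!: exI[of _ "\<lambda>i x. s i x + r i x"])
qed

text \<open>A single simple approximant at finite L1 distance is enough, by the triangle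
  inequality.\<close>

lemma has_strong_integral_imp_integrable_norm:
  fixes f :: "'a::euclidean_space \<Rightarrow> 'b::real_normed_vector"
  assumes "has_strong_integral lebesgue f I"
  shows "integrable lebesgue (\<lambda>t. norm (f t))"
proof -
  obtain s where meas: "strongly_measurable lebesgue f"
    and s: "\<And>i::nat. Bochner_Integration.simple_bochner_integrable lebesgue (s i)"
      "(\<lambda>i. \<integral>\<^sup>+x. norm (f x - s i x) \<partial>lebesgue) \<longlonglongrightarrow> 0"
    using assms by (auto simp: has_strong_integral_def)
  have sf: "simple_function lebesgue (s i)" for i
    using s(1)[of i] by (auto elim: Bochner_Integration.simple_bochner_integrable.cases)
  have m: "(\<lambda>t. norm (f t)) \<in> borel_measurable lebesgue"
    using strongly_measurable_norm_diff[OF meas simple_function_const[of _ 0]] by simp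
  obtain i where i: "(\<integral>\<^sup>+x. norm (f x - s i x) \<partial>lebesgue) < 1"
    using order_tendstoD(2)[OF s(2), of 1] eventually_sequentially by auto
  have sn: "Bochner_Integration.simple_bochner_integrable lebesgue (\<lambda>x. norm (s i x))"
    using s(1)[of i] by (auto intro: simple_bochner_integrable_compose2)
  have m2: "(\<lambda>x. norm (s i x)) \<in> borel_measurable lebesgue"
    using simple_function_compose1[OF sf, of norm] by (rule borel_measurable_simple_function)
  have "(\<integral>\<^sup>+x. norm (f x) \<partial>lebesgue) \<le> (\<integral>\<^sup>+x. ennreal (norm (f x - s i x)) + norm (s i x) \<partial>lebesgue)"
    by (intro nn_integral_mono)
      (use norm_triangle_sub in \<open>auto simp flip: ennreal_plus simp: add.commute\<close>)
  also have "\<dots> = (\<integral>\<^sup>+x. norm (f x - s i x) \<partial>lebesgue) + (\<integral>\<^sup>+x. norm (s i x) \<partial>lebesgue)"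
    using strongly_measurable_norm_diff[OF meas sf] m2 by (intro nn_integral_add) auto
  also have "\<dots> < \<infinity>"
  proof -
    have "has_bochner_integral lebesgue (\<lambda>x. norm (s i x)) (Bochner_Integration.simple_bochner_integral lebesgue (\<lambda>x. norm (s i x)))"
      using sn by (rule has_bochner_integral_simple_bochner_integrable)
    then have "integrable lebesgue (\<lambda>x. norm (s i x))"
      by (rule integrable.intros)
    then have "(\<integral>\<^sup>+x. norm (s i x) \<partial>lebesgue) < \<infinity>"
      by (simp add: integrable_iff_bounded)
    then show ?thesis
      using i ennreal_one_less_top by (metis ennreal_add_less_top infinity_ennreal_def order_less_trans)
  qed
  finally show ?thesis
    using m by (simp add: integrable_iff_bounded)
qed

text \<open>Gives scalar primitives access to the gauge integral, from which interval additivity and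
  comparison are taken below.\<close>

lemma has_strong_integral_on_real_iff:
  fixes f :: "real \<Rightarrow> real"
  shows "has_strong_integral_on f I S \<longleftrightarrow> f absolutely_integrable_on S \<and> integral S f = I"
proof -
  have "has_strong_integral_on f I S \<longleftrightarrow> has_bochner_integral lebesgue (\<lambda>t. indicator S t *\<^sub>R f t) I"
    by (simp add: has_strong_integral_on_def has_strong_integral_iff_has_bochner_integral)
  also have "\<dots> \<longleftrightarrow> f absolutely_integrable_on S \<and> set_lebesgue_integral lebesgue S f = I"
    by (simp add: has_bochner_integral_iff set_integrable_def set_lebesgue_integral_def)
  also have "\<dots> \<longleftrightarrow> f absolutely_integrable_on S \<and> integral S f = I"
    using set_lebesgue_integral_eq_integral(2)[of S f] by auto
  finally show ?thesis .
qed

lemma has_strong_integral_cong_AE: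
  assumes "AE x in M. f x = g x" "has_strong_integral M f I"
  shows "has_strong_integral M g I"
proof -
  have "(\<integral>\<^sup>+x. norm (f x - s x) \<partial>M) = (\<integral>\<^sup>+x. norm (g x - s x) \<partial>M)" for s
    by (rule nn_integral_cong_AE) (use assms(1) in eventually_elim, simp)
  moreover have "strongly_measurable M g" if f: "strongly_measurable M f"
  proof -
    obtain s where s: "\<And>i. simple_function M (s i)" "AE x in M. (\<lambda>i::nat. s i x) \<longlonglongrightarrow> f x"
      using f by (auto simp: strongly_measurable_def)
    have "AE x in M. (\<lambda>i::nat. s i x) \<longlonglongrightarrow> g x"
      using s(2) assms(1) by eventually_elim simp
    with s(1) show ?thesis by (auto simp: strongly_measurable_def)
  qed
  ultimately show ?thesis
    using assms(2) unfolding has_strong_integral_def by simp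
qed

subsection \<open>Calculus of primitives\<close>

lemma W11_loc_deriv_real_iff:
  fixes u v :: "real \<Rightarrow> real"
  shows "W11_loc_deriv u v \<longleftrightarrow> (\<forall>t\<ge>0. v absolutely_integrable_on {0..t} \<and> integral {0..t} v = u t - u 0)"
  by (simp add: W11_loc_deriv_def has_strong_integral_on_real_iff)

lemma W11_loc_deriv_absolutely_integrable:
  fixes u v :: "real \<Rightarrow> real"
  assumes "W11_loc_deriv u v" "0 \<le> s"
  shows "v absolutely_integrable_on {s..t}"
proof (cases "s \<le> t")
  case True
  then have "v absolutely_integrable_on {0..t}"
    using assms by (auto simp: W11_loc_deriv_real_iff)
  then show ?thesis
    by (rule absolutely_integrable_on_subinterval) (use assms in auto)
qed auto

lemma W11_loc_deriv_has_integral: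
  fixes u v :: "real \<Rightarrow> real"
  assumes u: "W11_loc_deriv u v" and "0 \<le> s" "s \<le> t"
  shows "(v has_integral (u t - u s)) {s..t}"
proof -
  have int: "v integrable_on {0..t}" "v integrable_on {s..t}"
    using W11_loc_deriv_absolutely_integrable[OF u] assms
    by (auto intro: set_lebesgue_integral_eq_integral(1))
  have "integral {0..s} v + integral {s..t} v = integral {0..t} v"
    using assms int by (intro Henstock_Kurzweil_Integration.integral_combine) auto
  then have "integral {s..t} v = u t - u s"
    using u assms by (simp add: W11_loc_deriv_real_iff)
  with int show ?thesis
    by (simp add: has_integral_iff)
qed

lemma W11_loc_deriv_bounded_linear:
  assumes T: "bounded_linear T" and u: "W11_loc_deriv u v"
  shows "W11_loc_deriv (\<lambda>t. T (u t)) (\<lambda>t. T (v t))"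
proof -
  interpret T: bounded_linear T by fact
  show ?thesis
    unfolding W11_loc_deriv_def has_strong_integral_on_def
  proof (intro allI impI)
    fix t :: real assume "0 \<le> t"
    then have "has_strong_integral lebesgue (\<lambda>r. indicator {0..t} r *\<^sub>R v r) (u t - u 0)"
      using u by (simp add: W11_loc_deriv_def has_strong_integral_on_def)
    from has_strong_integral_bounded_linear[OF T this]
    show "has_strong_integral lebesgue (\<lambda>r. indicator {0..t} r *\<^sub>R T (v r)) (T (u t) - T (u 0))"
      by (simp add: T.diff T.scaleR)
  qed
qed

lemma W11_loc_deriv_add:
  assumes "W11_loc_deriv u v" "W11_loc_deriv u' v'"
  shows "W11_loc_deriv (\<lambda>t. u t + u' t) (\<lambda>t. v t + v' t)"
  unfolding W11_loc_deriv_def has_strong_integral_on_def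
proof (intro allI impI)
  fix t :: real assume "0 \<le> t"
  then have "has_strong_integral lebesgue (\<lambda>r. indicator {0..t} r *\<^sub>R v r) (u t - u 0)"
      "has_strong_integral lebesgue (\<lambda>r. indicator {0..t} r *\<^sub>R v' r) (u' t - u' 0)"
    using assms by (simp_all add: W11_loc_deriv_def has_strong_integral_on_def)
  from has_strong_integral_add[OF this]
  show "has_strong_integral lebesgue (\<lambda>r. indicator {0..t} r *\<^sub>R (v r + v' r)) (u t + u' t - (u 0 + u' 0))"
    by (simp add: scaleR_add_right algebra_simps)
qed

lemma W11_loc_deriv_diff:
  assumes "W11_loc_deriv u v" "W11_loc_deriv u' v'"
  shows "W11_loc_deriv (\<lambda>t. u t - u' t) (\<lambda>t. v t - v' t)"
  using W11_loc_deriv_add[OF assms(1) W11_loc_deriv_bounded_linear[OF bounded_linear_minus[OF bounded_linear_ident] assms(2)]]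
  by simp

lemma W11_loc_deriv_Pair:
  assumes "W11_loc_deriv u v" "W11_loc_deriv u' v'"
  shows "W11_loc_deriv (\<lambda>t. (u t, u' t)) (\<lambda>t. (v t, v' t))"
proof -
  have "bounded_linear (\<lambda>x::'a. (x, 0::'b))" "bounded_linear (\<lambda>y::'b. (0::'a, y))"
    by (intro bounded_linear_Pair bounded_linear_ident bounded_linear_zero)+
  then show ?thesis
    using W11_loc_deriv_add[OF W11_loc_deriv_bounded_linear[OF _ assms(1)] W11_loc_deriv_bounded_linear[OF _ assms(2)]]
    by fastforce
qed

lemma W11_loc_deriv_cong_AE:
  assumes u: "W11_loc_deriv u v" and eq: "AE t in lebesgue. 0 \<le> t \<longrightarrow> v t = w t"
  shows "W11_loc_deriv u w"
  unfolding W11_loc_deriv_def has_strong_integral_on_def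
proof (intro allI impI)
  fix t :: real assume "0 \<le> t"
  then have "has_strong_integral lebesgue (\<lambda>r. indicator {0..t} r *\<^sub>R v r) (u t - u 0)"
    using u by (simp_all add: W11_loc_deriv_def has_strong_integral_on_def)
  moreover have "AE r in lebesgue. indicator {0..t} r *\<^sub>R v r = indicator {0..t} r *\<^sub>R w r"
    using eq by eventually_elim (auto simp: indicator_def)
  ultimately show "has_strong_integral lebesgue (\<lambda>r. indicator {0..t} r *\<^sub>R w r) (u t - u 0)"
    by (rule has_strong_integral_cong_AE[rotated])
qed

section \<open>Norm estimates and continuity of primitives\<close>

lemma W11_loc_deriv_norm_integrable:
  assumes u: "W11_loc_deriv u v" and "0 \<le> s"
  shows "(\<lambda>t. norm (v t)) absolutely_integrable_on {s..t}"
proof (cases "s \<le> t")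
  case True
  then have "has_strong_integral lebesgue (\<lambda>r. indicator {0..t} r *\<^sub>R v r) (u t - u 0)"
    using assms by (simp_all add: W11_loc_deriv_def has_strong_integral_on_def)
  then have "integrable lebesgue (\<lambda>r. norm (indicator {0..t} r *\<^sub>R v r))"
    by (rule has_strong_integral_imp_integrable_norm)
  then have "(\<lambda>t. norm (v t)) absolutely_integrable_on {0..t}"
    by (simp add: set_integrable_def)
  then show ?thesis
    by (rule absolutely_integrable_on_subinterval) (use assms in auto)
qed auto

text \<open>Testing with the increment \<open>x\<close> itself reduces the claim to a scalar
  integral; one factor \<open>norm x\<close> then cancels, which is why a vanishing increment is
  treated separately.\<close>

lemma W11_loc_deriv_norm_le:
  fixes u v :: "real \<Rightarrow> 'b::real_inner"
  assumes u: "W11_loc_deriv u v" and st: "0 \<le> s" "s \<le> t"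
  shows "norm (u t - u s) \<le> integral {s..t} (\<lambda>r. norm (v r))"
proof (cases "u t = u s")
  case True
  then show ?thesis by (simp add: Henstock_Kurzweil_Integration.integral_nonneg
        W11_loc_deriv_norm_integrable[OF u st(1)] set_lebesgue_integral_eq_integral(1))
next
  case False
  define x where "x = u t - u s"
  have "W11_loc_deriv (\<lambda>r. u r \<bullet> x) (\<lambda>r. v r \<bullet> x)"
    using u by (rule W11_loc_deriv_bounded_linear[OF bounded_linear_inner_left])
  from W11_loc_deriv_has_integral[OF this st]
  have i: "((\<lambda>r. v r \<bullet> x) has_integral x \<bullet> x) {s..t}"
    by (simp add: x_def inner_diff_left)
  have n: "(\<lambda>r. norm (v r)) integrable_on {s..t}"
    using W11_loc_deriv_norm_integrable[OF u st(1)] by (rule set_lebesgue_integral_eq_integral(1))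
  have "x \<bullet> x = integral {s..t} (\<lambda>r. v r \<bullet> x)"
    using i by (simp add: integral_unique)
  also have "\<dots> \<le> integral {s..t} (\<lambda>r. norm (v r) * norm x)"
    using i n by (intro integral_le norm_cauchy_schwarz integrable_on_mult_left) auto
  also have "\<dots> = integral {s..t} (\<lambda>r. norm (v r)) * norm x"
    by simp
  finally show ?thesis
    using False by (simp add: power2_norm_eq_inner[symmetric] power2_eq_square x_def)
qed

text \<open>Increments of \<open>u\<close> are dominated by those of \<open>W\<close>, the
  continuous scalar primitive of \<open>norm v\<close>.\<close>

lemma W11_loc_deriv_continuous_on:
  fixes u v :: "real \<Rightarrow> 'b::real_inner"
  assumes u: "W11_loc_deriv u v"
  shows "continuous_on {0..} u"
proof -
  have cont: "continuous_on {0..T} u" for T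
  proof -
    define W where "W = (\<lambda>t. integral {0..t} (\<lambda>r. norm (v r)))"
    have int: "(\<lambda>r. norm (v r)) integrable_on {0..T}" for T
      using W11_loc_deriv_norm_integrable[OF u order_refl] by (rule set_lebesgue_integral_eq_integral(1))
    have W: "continuous_on {0..T} W"
      unfolding W_def by (intro indefinite_integral_continuous_1 int)
    have le: "norm (u t - u s) \<le> W t - W s" if "0 \<le> s" "s \<le> t" for s t
    proof -
      have "W s + integral {s..t} (\<lambda>r. norm (v r)) = W t"
        unfolding W_def using that int by (intro Henstock_Kurzweil_Integration.integral_combine) auto
      then show ?thesis using W11_loc_deriv_norm_le[OF u that] by simp
    qed
    have dist: "dist (u s) (u t) \<le> dist (W s) (W t)" if "0 \<le> s" "0 \<le> t" for s t
      using le[of s t] le[of t s] that by (cases "s \<le> t") (auto simp: dist_norm norm_minus_commute)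
    show ?thesis
      unfolding continuous_on_iff
    proof (intro ballI allI impI)
      fix x e :: real assume xe: "x \<in> {0..T}" "0 < e"
      then obtain d where "d > 0" "\<forall>x'\<in>{0..T}. dist x' x < d \<longrightarrow> dist (W x') (W x) < e"
        using W[unfolded continuous_on_iff, rule_format, OF xe] by blast
      then show "\<exists>d>0. \<forall>x'\<in>{0..T}. dist x' x < d \<longrightarrow> dist (u x') (u x) < e"
        using dist \<open>x \<in> {0..T}\<close> by (metis atLeastAtMost_iff order_le_less_trans)
    qed
  qed
  show ?thesis
    unfolding continuous_on_eq_continuous_within
  proof
    fix x :: real assume x: "x \<in> {0..}"
    have "continuous (at x within {0..x+1}) u"
      using cont[of "x+1"] x by (auto simp: continuous_on_eq_continuous_within)
    moreover have "at x within {0..x+1} = at x within {0..}"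
      by (rule at_within_nhd[of _ "{x-1<..<x+1}"]) auto
    ultimately show "continuous (at x within {0..}) u" by simp
  qed
qed

lemma W11_loc_deriv_C1:
  fixes u v :: "real \<Rightarrow> real"
  assumes "\<And>t. 0 \<le> t \<Longrightarrow> (u has_real_derivative v t) (at t)" "continuous_on {0..} v"
  shows "W11_loc_deriv u v"
  unfolding W11_loc_deriv_real_iff
proof (intro allI impI conjI)
  fix t :: real assume t: "0 \<le> t"
  show "v absolutely_integrable_on {0..t}"
    using assms(2) by (intro absolutely_integrable_continuous_real) (auto elim: continuous_on_subset)
  have "(v has_integral u t - u 0) {0..t}"
    using t assms(1)
    by (intro fundamental_theorem_of_calculus)
      (auto simp: has_real_derivative_iff_has_vector_derivative intro: has_vector_derivative_at_within)
  then show "integral {0..t} v = u t - u 0"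
    by (rule integral_unique)
qed

text \<open>The constant is the image of the scalar constant 1 under scaling of the fixed vector
  \<open>c\<close>, so the scalar C1 case suffices.\<close>

lemma W11_loc_deriv_const: "W11_loc_deriv (\<lambda>_. c) (\<lambda>_. 0)"
  using W11_loc_deriv_bounded_linear[OF bounded_linear_scaleR_left[of c]
      W11_loc_deriv_C1[of "\<lambda>_. 1" "\<lambda>_. 0"]] by simp

text \<open>Instead of differentiating almost everywhere, the increments of both sides over short
  intervals are compared, and the errors are added up by \<open>Bolzano\<close>.\<close>

lemma W11_loc_deriv_chain:
  fixes u w :: "real \<Rightarrow> 'b::real_inner" and D :: "'b \<Rightarrow> 'b \<Rightarrow>\<^sub>L real"
  assumes u: "W11_loc_deriv u w"
    and \<Phi>: "\<And>x. (\<Phi> has_derivative blinfun_apply (D x)) (at x)" and D: "continuous_on UNIV D"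
  shows "W11_loc_deriv (\<lambda>t. \<Phi> (u t)) (\<lambda>t. D (u t) (w t))"
  unfolding W11_loc_deriv_real_iff
proof (intro allI impI)
  fix T :: real assume T: "0 \<le> T"
  define G where "G = (\<lambda>r. D (u r) (w r))"
  have cu: "continuous_on {0..} u"
    using u by (rule W11_loc_deriv_continuous_on)
  have cD: "continuous_on {0..T} (\<lambda>r. D (u r))"
    using cu D by (auto intro!: continuous_on_compose2[OF D] elim: continuous_on_subset)
  have meas: "strongly_measurable lebesgue (\<lambda>r. indicator {0..T} r *\<^sub>R w r)"
    using u T by (auto simp: W11_loc_deriv_def has_strong_integral_on_def has_strong_integral_def)
  \<comment> \<open>The inner indicator changes nothing under the outer one, but \<open>w\<close> is
    known to be strongly measurable only after truncation to \<open>{0..T}\<close>.\<close>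
  have "(\<lambda>r. (indicator {0..T} r *\<^sub>R D (u r) (indicator {0..T} r *\<^sub>R w r))) \<in> borel_measurable lebesgue"
  proof (rule strongly_measurable_superposition[OF meas])
    fix y
    have "(\<lambda>r. D (u r) y) absolutely_integrable_on {0..T}"
      by (intro absolutely_integrable_continuous_real continuous_intros cD)
    then show "(\<lambda>r. indicator {0..T} r *\<^sub>R D (u r) y) \<in> borel_measurable lebesgue"
      unfolding set_integrable_def by (rule borel_measurable_integrable)
  qed (intro continuous_intros)
  moreover have "(\<lambda>r. (indicator {0..T} r *\<^sub>R D (u r) (indicator {0..T} r *\<^sub>R w r))) = (\<lambda>r. indicator {0..T} r *\<^sub>R G r)"
    by (simp add: indicator_def G_def fun_eq_iff)
  ultimately have Gm: "(\<lambda>r. indicator {0..T} r *\<^sub>R G r) \<in> borel_measurable lebesgue"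
    by (simp only:)
  obtain B where B: "norm (D (u r)) \<le> B" if "r \<in> {0..T}" for r
    using compact_imp_bounded[OF compact_continuous_image[OF cD compact_Icc]]
    unfolding bounded_iff by blast
  have "integrable lebesgue (\<lambda>r. indicator {0..T} r *\<^sub>R G r)"
  proof (rule Bochner_Integration.integrable_bound[OF _ Gm])
    show "integrable lebesgue (\<lambda>r. B * (indicator {0..T} r *\<^sub>R norm (w r)))"
      using W11_loc_deriv_norm_integrable[OF u order_refl, of T] by (simp add: set_integrable_def)
    have "\<bar>G r\<bar> \<le> B * norm (w r)" if "r \<in> {0..T}" for r
    proof -
      have "\<bar>G r\<bar> \<le> norm (D (u r)) * norm (w r)"
        using norm_blinfun[of "D (u r)" "w r"] by (simp add: G_def)
      also have "\<dots> \<le> B * norm (w r)"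
        using B[OF that] by (intro mult_right_mono) auto
      finally show ?thesis .
    qed
    then show "AE r in lebesgue. norm (indicator {0..T} r *\<^sub>R G r) \<le> norm (B * (indicator {0..T} r *\<^sub>R norm (w r)))"
      by (intro AE_I2) (force simp: indicator_def)
  qed
  then have Ga: "G absolutely_integrable_on {0..T}"
    by (simp add: set_integrable_def)
  then have Gi: "G integrable_on {s..t}" if "0 \<le> s" "t \<le> T" for s t
    using that by (auto intro: integrable_on_subinterval set_lebesgue_integral_eq_integral(1))
  have ni: "(\<lambda>r. norm (w r)) integrable_on {s..t}" if "0 \<le> s" for s t
    using W11_loc_deriv_norm_integrable[OF u that] by (rule set_lebesgue_integral_eq_integral(1))
  have est: "\<bar>\<Phi> (u T) - \<Phi> (u 0) - integral {0..T} G\<bar> \<le> e * integral {0..T} (\<lambda>r. norm (w r))"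
    if e: "0 < e" for e
  proof -
    \<comment> \<open>The error bound is additive over adjacent intervals. The guard makes
      \<open>P\<close> vacuous for intervals leaving \<open>{0..T}\<close>, which the covering
      argument also presents and on which \<open>G\<close> is not known to be integrable.\<close>
    define P where "P = (\<lambda>s t. 0 \<le> s \<and> t \<le> T \<longrightarrow>
      \<bar>\<Phi> (u t) - \<Phi> (u s) - integral {s..t} G\<bar> \<le> e * integral {s..t} (\<lambda>r. norm (w r)))"
    have "P 0 T"
      using T
    proof (induction rule: Bolzano)
      case (trans a b c)
      show ?case
        unfolding P_def
      proof (intro impI)
        assume ac: "0 \<le> a \<and> c \<le> T"
        have "integral {a..b} G + integral {b..c} G = integral {a..c} G"
             "integral {a..b} (\<lambda>r. norm (w r)) + integral {b..c} (\<lambda>r. norm (w r)) = integral {a..c} (\<lambda>r. norm (w r))"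
          using trans ac by (intro Henstock_Kurzweil_Integration.integral_combine Gi ni; simp)+
        moreover from this(2)
        have "e * integral {a..b} (\<lambda>r. norm (w r)) + e * integral {b..c} (\<lambda>r. norm (w r)) = e * integral {a..c} (\<lambda>r. norm (w r))"
          by (metis distrib_left)
        ultimately show "\<bar>\<Phi> (u c) - \<Phi> (u a) - integral {a..c} G\<bar> \<le> e * integral {a..c} (\<lambda>r. norm (w r))"
          using trans ac unfolding P_def by (smt (verit))
      qed
    next
      case (local x)
      \<comment> \<open>The tolerance \<open>e\<close> is spent in two halves: \<open>e / 2\<close>
        for linearising \<open>\<Phi>\<close> between \<open>u a\<close> and \<open>u b\<close>, and
        \<open>e / 2\<close> for freezing \<open>D (u r)\<close> at \<open>D (u x)\<close> under the
        integral.\<close>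
      have "isCont D (u x)"
        using D by (simp add: continuous_on_eq_continuous_at)
      then obtain \<rho> where \<rho>: "\<rho> > 0" "\<And>y. dist y (u x) < \<rho> \<Longrightarrow> dist (D y) (D (u x)) < e / 2"
        using e by (metis half_gt_zero continuous_at_eps_delta)
      obtain d where d: "d > 0" "\<And>r. 0 \<le> r \<Longrightarrow> dist r x < d \<Longrightarrow> dist (u r) (u x) < \<rho>"
        using cu[unfolded continuous_on_iff, rule_format, of x, OF _ \<rho>(1)] local by auto
      have "P a b" if ab: "a \<le> x" "x \<le> b" "b - a < d" for a b
        unfolding P_def
      proof (intro impI)
        assume ab': "0 \<le> a \<and> b \<le> T"
        have ur: "u r \<in> ball (u x) \<rho>" if "r \<in> {a..b}" for r
          using d(2)[of r] that ab ab' by (auto simp: dist_commute dist_real_def)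
        have 1: "norm (\<Phi> (u b) - \<Phi> (u a) - D (u x) (u b - u a)) \<le> norm (u b - u a) * (e/2)"
        proof (rule differentiable_bound_linearization[where S = "ball (u x) \<rho>"])
          show "u a + t *\<^sub>R (u b - u a) \<in> ball (u x) \<rho>" if "t \<in> {0..1}" for t
            using convexD_alt[OF convex_ball ur[of a] ur[of b], of t] that ab by (auto simp: algebra_simps)
          show "(\<Phi> has_derivative blinfun_apply (D y)) (at y within ball (u x) \<rho>)" for y
            using \<Phi> has_derivative_at_withinI by blast
          show "onorm (blinfun_apply (D y) - blinfun_apply (D (u x))) \<le> e / 2" if "y \<in> ball (u x) \<rho>" for y
            using \<rho>(2)[of y] that
            by (simp add: dist_norm norm_blinfun.rep_eq norm_minus_commute fun_diff_def flip: blinfun.diff_left)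
        qed (use \<rho> in auto)
        have "W11_loc_deriv (\<lambda>r. D (u x) (u r)) (\<lambda>r. D (u x) (w r))"
          using u by (intro W11_loc_deriv_bounded_linear[OF blinfun.bounded_linear_right])
        from W11_loc_deriv_has_integral[OF this, of a b]
        have i: "((\<lambda>r. D (u x) (w r)) has_integral D (u x) (u b - u a)) {a..b}"
          using ab ab' by (simp add: blinfun.diff_right)
        have "((\<lambda>r. G r - D (u x) (w r)) has_integral (integral {a..b} G - D (u x) (u b - u a))) {a..b}"
          using Gi[of a b] ab' i by (intro has_integral_diff) auto
        then have 2: "\<bar>integral {a..b} G - D (u x) (u b - u a)\<bar> \<le> integral {a..b} (\<lambda>r. e/2 * norm (w r))"
        proof -
          have "norm (integral {a..b} (\<lambda>r. G r - D (u x) (w r))) \<le> integral {a..b} (\<lambda>r. e/2 * norm (w r))"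
          proof (rule integral_norm_bound_integral)
            fix r assume r: "r \<in> {a..b}"
            have "norm (G r - D (u x) (w r)) \<le> norm (D (u r) - D (u x)) * norm (w r)"
              unfolding G_def by (metis blinfun.diff_left norm_blinfun)
            also have "\<dots> \<le> e/2 * norm (w r)"
              using \<rho>(2)[of "u r"] ur[OF r] by (intro mult_right_mono) (auto simp: dist_norm dist_commute norm_minus_commute)
            finally show "norm (G r - D (u x) (w r)) \<le> e/2 * norm (w r)" .
          qed (use ab' i Gi ni in \<open>auto intro!: integrable_diff integrable_on_mult_right\<close>)
          then show ?thesis
            using Gi[of a b] ab' i by (simp add: Henstock_Kurzweil_Integration.integral_diff integral_unique has_integral_integrable)
        qed
        have 3: "norm (u b - u a) \<le> integral {a..b} (\<lambda>r. norm (w r))"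
          using u ab ab' by (intro W11_loc_deriv_norm_le) auto
        then have "norm (u b - u a) * (e/2) \<le> integral {a..b} (\<lambda>r. norm (w r)) * (e/2)"
          using e by (intro mult_right_mono) auto
        then show "\<bar>\<Phi> (u b) - \<Phi> (u a) - integral {a..b} G\<bar> \<le> e * integral {a..b} (\<lambda>r. norm (w r))"
          using 1 2 by (simp add: mult.commute[of e]) argo
      qed
      then show ?case
        using d(1) by blast
    qed
    then show ?thesis
      using T by (simp add: P_def)
  qed
  have "((\<lambda>e. e * integral {0..T} (\<lambda>r. norm (w r))) \<longlongrightarrow> 0 * integral {0..T} (\<lambda>r. norm (w r))) (at_right 0)"
    by (intro tendsto_intros)
  then have "\<bar>\<Phi> (u T) - \<Phi> (u 0) - integral {0..T} G\<bar> \<le> 0"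
    by (intro tendsto_lowerbound[of "\<lambda>e. e * integral {0..T} (\<lambda>r. norm (w r))"])
      (auto intro!: eventually_at_rightI[of 0 1] est)
  then show "(\<lambda>t. D (u t) (w t)) absolutely_integrable_on {0..T} \<and> integral {0..T} (\<lambda>t. D (u t) (w t)) = \<Phi> (u T) - \<Phi> (u 0)"
    using Ga by (simp add: G_def)
qed

text \<open>The product rule is the chain rule for the inner product, viewed as a C1 function of the
  pair \<open>(u t, u' t)\<close>.\<close>

lemma W11_loc_deriv_inner:
  fixes u v u' v' :: "real \<Rightarrow> 'b::real_inner"
  assumes "W11_loc_deriv u v" "W11_loc_deriv u' v'"
  shows "W11_loc_deriv (\<lambda>t. u t \<bullet> u' t) (\<lambda>t. u t \<bullet> v' t + v t \<bullet> u' t)"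
proof -
  define D :: "'b \<times> 'b \<Rightarrow> ('b \<times> 'b) \<Rightarrow>\<^sub>L real" where
    "D z = (blinfun_inner_right (fst z) o\<^sub>L snd_blinfun) + (blinfun_inner_right (snd z) o\<^sub>L fst_blinfun)" for z
  have "W11_loc_deriv (\<lambda>t. (\<lambda>z. fst z \<bullet> snd z) (u t, u' t)) (\<lambda>t. D (u t, u' t) (v t, v' t))"
  proof (rule W11_loc_deriv_chain[OF W11_loc_deriv_Pair[OF assms]])
    show "((\<lambda>z. fst z \<bullet> snd z) has_derivative blinfun_apply (D x)) (at x)" for x
      by (auto intro!: derivative_eq_intros simp: D_def blinfun.add_left inner_commute)
    show "continuous_on UNIV D"
      unfolding D_def
      by (intro continuous_intros bounded_linear.continuous_on[OF bounded_linear_blinfun_inner_right])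
  qed
  then show ?thesis
    by (simp add: D_def blinfun.add_left inner_commute add.commute)
qed

lemma W11_loc_deriv_mult:
  fixes u v u' v' :: "real \<Rightarrow> real"
  assumes "W11_loc_deriv u v" "W11_loc_deriv u' v'"
  shows "W11_loc_deriv (\<lambda>t. u t * u' t) (\<lambda>t. u t * v' t + v t * u' t)"
  using W11_loc_deriv_inner[OF assms] by simp

section \<open>Uniqueness of the weak derivative, and pointwise bounds from essential ones\<close>

lemma AE_nonneg_iff_nat_Icc:
  "(AE t in lebesgue. 0 \<le> t \<longrightarrow> P t) \<longleftrightarrow> (\<forall>n::nat. AE t in lebesgue. t \<in> {0..real n} \<longrightarrow> P t)"
proof
  assume "\<forall>n::nat. AE t in lebesgue. t \<in> {0..real n} \<longrightarrow> P t"
  then have "AE t in lebesgue. \<forall>n::nat. t \<in> {0..real n} \<longrightarrow> P t"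
    by (intro AE_all_countable[THEN iffD2]) blast
  then show "AE t in lebesgue. 0 \<le> t \<longrightarrow> P t"
    by eventually_elim (use real_arch_simple in auto)
next
  assume *: "AE t in lebesgue. 0 \<le> t \<longrightarrow> P t"
  show "\<forall>n::nat. AE t in lebesgue. t \<in> {0..real n} \<longrightarrow> P t"
    using * by (auto elim: eventually_mono)
qed

text \<open>The positive and negative parts of the density define measures agreeing on all half-lines.\<close>

lemma W11_loc_deriv_const_imp_AE_zero_real:
  fixes f :: "real \<Rightarrow> real"
  assumes f: "W11_loc_deriv (\<lambda>_. c) f"
  shows "AE t in lebesgue. 0 \<le> t \<longrightarrow> f t = 0"
  unfolding AE_nonneg_iff_nat_Icc
proof
  fix n :: nat
  define F where "F = (\<lambda>t. indicator {0..real n} t *\<^sub>R f t)"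
  have fa: "f absolutely_integrable_on {0..real n}"
    using f by (rule W11_loc_deriv_absolutely_integrable) simp
  then have F: "integrable lebesgue F"
    by (simp add: F_def set_integrable_def)
  \<comment> \<open>A Borel representative is needed for densities with respect to
    \<open>lborel\<close>; \<open>F\<close> is measurable only for the completed measure.\<close>
  then obtain g where g[measurable]: "g \<in> borel_measurable lborel" and Fg': "AE x in lborel. F x = g x"
    using completion_ex_borel_measurable_real[of F lborel] by (auto dest: borel_measurable_integrable)
  from Fg' have Fg: "AE x in lebesgue. F x = g x"
    by (rule AE_completion)
  have gi: "integrable lebesgue g"
    using F Fg g by (subst integrable_cong_AE[of _ _ F])
      (auto simp: measurable_completion elim: eventually_mono)
  then have gi: "integrable lborel g"
    using g integrable_completion by blast
  have zero: "(LINT t|lborel. g t * indicator {x<..} t) = 0" for x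
  proof -
    have "(LINT t|lborel. g t * indicator {x<..} t) = (LINT t|lebesgue. g t * indicator {x<..} t)"
      by (rule integral_completion[symmetric]) measurable
    \<comment> \<open>Inside \<open>{0..n}\<close> the open half-line \<open>{x<..}\<close> leaves
      \<open>{max x 0..n}\<close> without \<open>x\<close>; the removed point matters only for
      \<open>x \<ge> 0\<close> and is negligible in the next steps.\<close>
    also have "\<dots> = (LINT t|lebesgue. indicator ({max x 0..real n} - {x}) t *\<^sub>R f t)"
    proof (rule integral_cong_AE)
      show "(\<lambda>t. g t * indicat_real {x<..} t) \<in> borel_measurable lebesgue"
        by (rule measurable_completion) measurable
      have "f absolutely_integrable_on ({max x 0..real n} - {x})"
        by (rule set_integrable_subset[OF fa]) auto
      then show "(\<lambda>t. indicat_real ({max x 0..real n} - {x}) t *\<^sub>R f t) \<in> borel_measurable lebesgue"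
        by (auto simp: set_integrable_def)
      show "AE t in lebesgue. g t * indicat_real {x<..} t = indicat_real ({max x 0..real n} - {x}) t *\<^sub>R f t"
        using Fg by eventually_elim (auto simp: F_def indicator_def split: if_splits)
    qed
    also have "\<dots> = integral ({max x 0..real n} - {x}) f"
    proof -
      have "f absolutely_integrable_on ({max x 0..real n} - {x})"
        by (rule set_integrable_subset[OF fa]) auto
      from set_lebesgue_integral_eq_integral(2)[OF this]
      show ?thesis by (simp add: set_lebesgue_integral_def)
    qed
    also have "\<dots> = integral {max x 0..real n} f"
      by (rule integral_subset_negligible) (auto intro: negligible_subset[of "{x}"])
    also have "\<dots> = 0"
    proof (cases "max x 0 \<le> n")
      case True
      then show ?thesis
        using W11_loc_deriv_has_integral[OF f, of "max x 0" n] by (simp add: integral_unique)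
    qed auto
    finally show ?thesis .
  qed
  have "density lborel (\<lambda>t. ennreal (g t)) = density lborel (\<lambda>t. ennreal (- g t))"
  proof (rule measure_eqI_lessThan)
    fix x
    have gx: "integrable lborel (\<lambda>t. g t * indicator {x<..} t)"
      using gi by (intro integrable_real_mult_indicator) auto
    have eq: "ennreal (g t) * indicator {x<..} t = ennreal (g t * indicator {x<..} t)"
             "ennreal (- g t) * indicator {x<..} t = ennreal (- (g t * indicator {x<..} t))" for t
      by (auto simp: indicator_def)
    have fin: "(\<integral>\<^sup>+t. ennreal (g t * indicator {x<..} t) \<partial>lborel) \<noteq> \<infinity>"
         "(\<integral>\<^sup>+t. ennreal (- (g t * indicator {x<..} t)) \<partial>lborel) \<noteq> \<infinity>"
      using gx by (auto simp: real_integrable_def)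
    then show "emeasure (density lborel (\<lambda>t. ennreal (g t))) {x<..} < \<infinity>"
      by (simp add: emeasure_density eq less_top)
    have "enn2real (\<integral>\<^sup>+t. ennreal (g t * indicator {x<..} t) \<partial>lborel) =
          enn2real (\<integral>\<^sup>+t. ennreal (- (g t * indicator {x<..} t)) \<partial>lborel)"
      using zero[of x] by (simp add: real_lebesgue_integral_def[OF gx])
    then have "(\<integral>\<^sup>+t. ennreal (g t * indicator {x<..} t) \<partial>lborel) =
          (\<integral>\<^sup>+t. ennreal (- (g t * indicator {x<..} t)) \<partial>lborel)"
      using fin ennreal_enn2real_if by (smt (verit) infinity_ennreal_def)
    then show "emeasure (density lborel (\<lambda>t. ennreal (g t))) {x<..} = emeasure (density lborel (\<lambda>t. ennreal (- g t))) {x<..}"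
      by (simp add: emeasure_density eq)
  qed auto
  then have "AE t in lborel. ennreal (g t) = ennreal (- g t)"
    by (intro sigma_finite_measure.density_unique[OF sigma_finite_lborel]) auto
  then have "AE t in lebesgue. ennreal (g t) = ennreal (- g t)"
    by (rule AE_completion)
  then show "AE t in lebesgue. t \<in> {0..real n} \<longrightarrow> f t = 0"
    using Fg
  proof eventually_elim
    case (elim t)
    then have "g t = 0"
      by (cases "0 \<le> g t") (simp_all add: ennreal_neg ennreal_eq_0_iff)
    then show ?case using elim by (auto simp: F_def)
  qed
qed

text \<open>Pairing with a fixed vector gives the scalar case, with one null set per vector.
  Countably many vectors suffice: the values of the simple functions that approximate the difference
  \<open>z\<close>. Since \<open>z t\<close> is a limit of such values and orthogonal to all of
  them, \<open>z t \<bullet> z t = 0\<close>.\<close>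

lemma W11_loc_deriv_unique:
  fixes u v w :: "real \<Rightarrow> 'b::real_inner"
  assumes "W11_loc_deriv u v" "W11_loc_deriv u w"
  shows "AE t in lebesgue. 0 \<le> t \<longrightarrow> v t = w t"
proof -
  define z where "z = (\<lambda>t. v t - w t)"
  have z: "W11_loc_deriv (\<lambda>_. 0) z"
    using W11_loc_deriv_diff[OF assms] by (simp add: z_def)
  have "AE t in lebesgue. t \<in> {0..real n} \<longrightarrow> z t = 0" for n :: nat
  proof -
    have "strongly_measurable lebesgue (\<lambda>r. indicator {0..real n} r *\<^sub>R z r)"
      using z by (auto simp: W11_loc_deriv_def has_strong_integral_on_def has_strong_integral_def)
    then obtain s where s: "\<And>i. simple_function lebesgue (s i)"
      and lim: "AE t in lebesgue. (\<lambda>i::nat. s i t) \<longlonglongrightarrow> indicator {0..real n} t *\<^sub>R z t"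
      by (auto simp: strongly_measurable_def)
    define Y where "Y = (\<Union>i. range (s i))"
    have "countable Y"
      unfolding Y_def using s
      by (intro countable_UN) (auto simp: simple_function_def intro: countable_finite)
    moreover have "AE t in lebesgue. 0 \<le> t \<longrightarrow> z t \<bullet> y = 0" for y
    proof (rule W11_loc_deriv_const_imp_AE_zero_real)
      show "W11_loc_deriv (\<lambda>_. 0) (\<lambda>t. z t \<bullet> y)"
        using W11_loc_deriv_bounded_linear[OF bounded_linear_inner_left z] by simp
    qed
    ultimately have "AE t in lebesgue. \<forall>y\<in>Y. 0 \<le> t \<longrightarrow> z t \<bullet> y = 0"
      by (subst AE_ball_countable) auto
    then show ?thesis
      using lim
    proof eventually_elim
      case (elim t)
      show ?case
      proof
        assume t: "t \<in> {0..real n}"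
        then have "(\<lambda>i. z t \<bullet> s i t) \<longlonglongrightarrow> z t \<bullet> z t"
          using elim(2) by (auto intro!: tendsto_intros)
        moreover have "z t \<bullet> s i t = 0" for i
          using elim(1) t by (auto simp: Y_def)
        ultimately show "z t = 0"
          by (simp add: LIMSEQ_const_iff)
      qed
    qed
  qed
  then show ?thesis
    by (simp add: AE_nonneg_iff_nat_Icc z_def)
qed

text \<open>A violation would persist on a nonempty open set, which is not negligible;
  \<open>0 < t\<close> keeps this set away from the end point of the half-line.\<close>

lemma AE_imp_bounded_of_continuous:
  fixes u :: "real \<Rightarrow> real"
  assumes "continuous_on {0..} u" "AE t in lebesgue. 0 \<le> t \<longrightarrow> u t \<le> C" "0 < t"
  shows "u t \<le> C"
proof (rule ccontr)
  assume "\<not> u t \<le> C"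
  define S where "S = {r \<in> {0<..}. u r \<in> {C<..}}"
  have "continuous_on {0<..} u"
    using assms(1) by (rule continuous_on_subset) auto
  then have "open S"
    unfolding S_def by (intro continuous_open_preimage[unfolded vimage_def Int_def mem_Collect_eq, of "{0<..}" u]) auto
  moreover have "S \<noteq> {}"
    using \<open>\<not> u t \<le> C\<close> assms(3) by (auto simp: S_def)
  ultimately have "\<not> negligible S"
    by (rule open_not_negligible)
  obtain N where N: "N \<in> null_sets lebesgue" "\<And>x. x \<notin> N \<Longrightarrow> 0 \<le> x \<longrightarrow> u x \<le> C"
    using assms(2) by (auto elim!: AE_E3)
  have "S \<subseteq> N"
    using N(2) by (force simp: S_def)
  then have "negligible S"
    using N(1) negligible_iff_null_sets negligible_subset by blast
  with \<open>\<not> negligible S\<close> show False by simp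
qed

subsection \<open>Scalar differential inequalities in integrated form\<close>

lemma antimono_bounded_below_tendsto:
  fixes X :: "real \<Rightarrow> real"
  assumes dec: "\<And>s t. t1 \<le> s \<Longrightarrow> s \<le> t \<Longrightarrow> X t \<le> X s" and lb: "\<And>t. t1 \<le> t \<Longrightarrow> c \<le> X t"
  shows "\<exists>L. (X \<longlongrightarrow> L) at_top"
proof -
  define L where "L = Inf (X ` {t1..})"
  have bb: "bdd_below (X ` {t1..})"
    using lb by (auto intro!: bdd_belowI[of _ c])
  have "(X \<longlongrightarrow> L) at_top"
  proof (rule order_tendstoI)
    fix y assume "y < L"
    then have "y < X t" if "t1 \<le> t" for t
      using cInf_lower[of "X t", OF _ bb] that by (force simp: L_def)
    then show "\<forall>\<^sub>F t in at_top. y < X t"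
      unfolding eventually_at_top_linorder by blast
  next
    fix y assume "L < y"
    then obtain s where s: "t1 \<le> s" "X s < y"
      unfolding L_def using bb by (auto simp: cInf_less_iff)
    show "\<forall>\<^sub>F t in at_top. X t < y"
      using eventually_ge_at_top[of s] by eventually_elim (use dec s in force)
  qed
  then show ?thesis ..
qed

lemma integral_split_Icc:
  fixes n :: "real \<Rightarrow> real"
  assumes int: "\<And>s t. t1 \<le> s \<Longrightarrow> n integrable_on {s..t}" and st: "t1 \<le> s" "s \<le> t"
  shows "integral {s..t} n = integral {t1..t} n - integral {t1..s} n"
proof -
  have "integral {t1..s} n + integral {s..t} n = integral {t1..t} n"
    using st int by (intro Henstock_Kurzweil_Integration.integral_combine) auto
  then show ?thesis by simp
qed

text \<open>With \<open>N\<close> the primitive of \<open>n\<close>, both \<open>- N\<close> and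
  \<open>X - N\<close> are nonincreasing and bounded below, so \<open>X\<close> is a difference of
  two convergent functions.\<close>

lemma increments_le_integral_tendsto:
  fixes X n :: "real \<Rightarrow> real"
  assumes X: "\<And>s t. t1 \<le> s \<Longrightarrow> s \<le> t \<Longrightarrow> X t - X s \<le> integral {s..t} n"
    and int: "\<And>s t. t1 \<le> s \<Longrightarrow> n integrable_on {s..t}"
    and n: "\<And>t. t1 \<le> t \<Longrightarrow> 0 \<le> n t" and bound: "\<And>t. t1 \<le> t \<Longrightarrow> integral {t1..t} n \<le> B"
    and lb: "\<And>t. t1 \<le> t \<Longrightarrow> c \<le> X t"
  shows "\<exists>L. (X \<longlongrightarrow> L) at_top"
proof -
  define N where "N = (\<lambda>t. integral {t1..t} n)"
  have split: "integral {s..t} n = N t - N s" if "t1 \<le> s" "s \<le> t" for s t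
    unfolding N_def using int that by (rule integral_split_Icc)
  have "\<exists>L. ((\<lambda>t. - N t) \<longlongrightarrow> L) at_top"
  proof (rule antimono_bounded_below_tendsto[of t1 _ "- B"])
    show "- N t \<le> - N s" if st: "t1 \<le> s" "s \<le> t" for s t
    proof -
      have "0 \<le> integral {s..t} n"
        using int n st by (intro Henstock_Kurzweil_Integration.integral_nonneg) auto
      then show ?thesis using split[OF st] by simp
    qed
    show "- B \<le> - N t" if "t1 \<le> t" for t
      using bound[OF that] by (simp add: N_def)
  qed
  moreover have "\<exists>L. ((\<lambda>t. X t - N t) \<longlongrightarrow> L) at_top"
  proof (rule antimono_bounded_below_tendsto[of t1 _ "c - B"])
    show "X t - N t \<le> X s - N s" if "t1 \<le> s" "s \<le> t" for s t
      using X[OF that] split[OF that] by simp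
    show "c - B \<le> X t - N t" if "t1 \<le> t" for t
      using lb[OF that] bound[OF that] by (simp add: N_def)
  qed
  ultimately obtain L L' where "((\<lambda>t. - N t) \<longlongrightarrow> L) at_top" "((\<lambda>t. X t - N t) \<longlongrightarrow> L') at_top"
    by auto
  from tendsto_diff[OF this(2,1)] show ?thesis by auto
qed

text \<open>The second inequality bounds the integral of \<open>a\<close> by that of \<open>b\<close> up to a multiple of
  the square root of \<open>Y\<close>; inserted into the first one at a maximum point of \<open>Y\<close>, this gives
  a quadratic inequality for the square root of the maximum.\<close>

lemma coupled_inequalities_bounded:
  fixes Y Z a b k m :: "real \<Rightarrow> real"
  assumes K: "0 < K" and C: "0 \<le> C" and Y: "continuous_on {t1..} Y" "\<And>t. t1 \<le> t \<Longrightarrow> 0 \<le> Y t"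
    and int: "\<And>s t. t1 \<le> s \<Longrightarrow> a integrable_on {s..t}" "\<And>s t. t1 \<le> s \<Longrightarrow> b integrable_on {s..t}"
      "\<And>s t. t1 \<le> s \<Longrightarrow> k integrable_on {s..t}" "\<And>s t. t1 \<le> s \<Longrightarrow> m integrable_on {s..t}"
    and nonneg: "\<And>t. t1 \<le> t \<Longrightarrow> 0 \<le> b t" "\<And>t. t1 \<le> t \<Longrightarrow> 0 \<le> k t"
    and Y_le: "\<And>s t R. t1 \<le> s \<Longrightarrow> s \<le> t \<Longrightarrow> (\<And>r. s \<le> r \<Longrightarrow> r \<le> t \<Longrightarrow> sqrt (2 * Y r) \<le> R) \<Longrightarrow>
        Y t - Y s \<le> integral {s..t} (\<lambda>r. K / 3 * a r - K * b r + R * k r)"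
    and Z_le: "\<And>s t. t1 \<le> s \<Longrightarrow> s \<le> t \<Longrightarrow> Z t - Z s \<le> integral {s..t} (\<lambda>r. 3 / 2 * b r - a r + m r)"
    and Z_abs: "\<And>t. t1 \<le> t \<Longrightarrow> \<bar>Z t\<bar> \<le> C * sqrt (2 * Y t) + B"
    and k: "\<And>t. t1 \<le> t \<Longrightarrow> integral {t1..t} k \<le> kb" and m: "\<And>t. t1 \<le> t \<Longrightarrow> integral {t1..t} m \<le> mb"
  shows "\<exists>M. \<forall>t\<ge>t1. Y t \<le> M \<and> integral {t1..t} a \<le> M \<and> integral {t1..t} b \<le> M"
proof -
  define G where "G = mb + \<bar>Z t1\<bar> + B"
  have A: "integral {t1..T} a \<le> 3 / 2 * integral {t1..T} b + G + C * sqrt (2 * Y T)" if "t1 \<le> T" for T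
  proof -
    have "Z T - Z t1 \<le> integral {t1..T} (\<lambda>r. 3 / 2 * b r - a r + m r)"
      using that by (intro Z_le) auto
    also have "\<dots> = 3 / 2 * integral {t1..T} b - integral {t1..T} a + integral {t1..T} m"
    proof (rule integral_unique)
      show "((\<lambda>r. 3 / 2 * b r - a r + m r) has_integral
        3 / 2 * integral {t1..T} b - integral {t1..T} a + integral {t1..T} m) {t1..T}"
        using int[of t1 T] by (intro has_integral_add has_integral_diff has_integral_mult_right integrable_integral) auto
    qed
    finally show ?thesis
      using m[OF that] Z_abs[OF that] by (simp add: G_def)
  qed
  have main: "Y T + K / 2 * integral {t1..T} b \<le> Y t1 + K / 3 * G + K / 3 * C * sqrt (2 * Y T) + R * kb"
    if T: "t1 \<le> T" and R: "\<And>r. t1 \<le> r \<Longrightarrow> r \<le> T \<Longrightarrow> sqrt (2 * Y r) \<le> R" for T R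
  proof -
    have "0 \<le> R"
      using R[of T] Y(2)[OF T] T by (smt (verit) real_sqrt_ge_zero)
    have "Y T - Y t1 \<le> integral {t1..T} (\<lambda>r. K / 3 * a r - K * b r + R * k r)"
      using T R by (intro Y_le) auto
    also have "\<dots> = K / 3 * integral {t1..T} a - K * integral {t1..T} b + R * integral {t1..T} k"
    proof (rule integral_unique)
      show "((\<lambda>r. K / 3 * a r - K * b r + R * k r) has_integral
        K / 3 * integral {t1..T} a - K * integral {t1..T} b + R * integral {t1..T} k) {t1..T}"
        using int[of t1 T] by (intro has_integral_add has_integral_diff has_integral_mult_right integrable_integral) auto
    qed
    \<comment> \<open>Here the loop closes: \<open>K / 3 * (3 / 2) = K / 2\<close>, so half of the
      dissipation \<open>K * integral {t1..T} b\<close> survives and moves to the left-hand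
      side.\<close>
    also have "\<dots> \<le> K / 3 * (3 / 2 * integral {t1..T} b + G + C * sqrt (2 * Y T)) - K * integral {t1..T} b + R * kb"
      using A[OF T] k[OF T] K \<open>0 \<le> R\<close> by (intro add_mono diff_mono mult_left_mono) auto
    finally show ?thesis
      by (simp add: algebra_simps)
  qed
  have kb: "0 \<le> kb"
    using k[of t1] by simp
  have b0: "0 \<le> integral {t1..T} b" if "t1 \<le> T" for T
    using int nonneg that by (intro Henstock_Kurzweil_Integration.integral_nonneg) auto
  define P Q where "P = Y t1 + K / 3 * G" and "Q = K / 3 * C + kb"
  \<comment> \<open>From \<open>Y S \<le> P + Q * sqrt (2 * Y S)\<close>: completing the square
    gives \<open>Q * sqrt (2 * Y S) \<le> Y S / 2 + Q^2\<close>, and half of \<open>Y S\<close> is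
    absorbed.\<close>
  define M1 where "M1 = 2 * P + 2 * Q\<^sup>2"
  have Q: "0 \<le> Q"
    using K C kb by (simp add: Q_def)
  have YM: "Y T \<le> M1" if T: "t1 \<le> T" for T
  proof -
    have "continuous_on {t1..T} Y"
      using Y(1) by (rule continuous_on_subset) auto
    then obtain S where S: "S \<in> {t1..T}" "\<And>r. r \<in> {t1..T} \<Longrightarrow> Y r \<le> Y S"
      using continuous_attains_sup[of "{t1..T}" Y] T by auto
    have "Y S + K / 2 * integral {t1..S} b \<le> Y t1 + K / 3 * G + K / 3 * C * sqrt (2 * Y S) + sqrt (2 * Y S) * kb"
      using S by (intro main) auto
    moreover have "0 \<le> K / 2 * integral {t1..S} b"
      using b0[of S] S(1) K by simp
    ultimately have "Y S \<le> Y t1 + K / 3 * G + K / 3 * C * sqrt (2 * Y S) + sqrt (2 * Y S) * kb"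
      by linarith
    then have 1: "Y S \<le> P + Q * sqrt (2 * Y S)"
      by (simp add: P_def Q_def algebra_simps)
    have "0 \<le> (sqrt (2 * Y S) - 2 * Q)\<^sup>2"
      by simp
    also have "\<dots> = 2 * Y S - 4 * (Q * sqrt (2 * Y S)) + 4 * Q\<^sup>2"
      using Y(2)[of S] S(1) by (simp add: power2_diff power_mult_distrib algebra_simps)
    finally have "Y S \<le> M1"
      using 1 by (simp add: M1_def)
    then show ?thesis
      using S(2)[of T] T by simp
  qed
  have sqrt_le: "sqrt (2 * Y t) \<le> sqrt (2 * M1)" if "t1 \<le> t" for t
    using YM[OF that] by simp
  define M2 where "M2 = (P + Q * sqrt (2 * M1)) / (K / 2)"
  have BM: "integral {t1..T} b \<le> M2" if T: "t1 \<le> T" for T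
  proof -
    have "Y T + K / 2 * integral {t1..T} b \<le> Y t1 + K / 3 * G + K / 3 * C * sqrt (2 * Y T) + sqrt (2 * M1) * kb"
      using T sqrt_le by (intro main) auto
    moreover have "K / 3 * C * sqrt (2 * Y T) \<le> K / 3 * C * sqrt (2 * M1)"
      using sqrt_le[OF T] K C by (intro mult_left_mono) auto
    ultimately have "K / 2 * integral {t1..T} b \<le> P + Q * sqrt (2 * M1)"
      using Y(2)[OF T] by (simp add: P_def Q_def algebra_simps)
    then show ?thesis
      using K by (simp add: M2_def field_simps)
  qed
  have AM: "integral {t1..T} a \<le> 3 / 2 * M2 + G + C * sqrt (2 * M1)" if T: "t1 \<le> T" for T
    using A[OF T] BM[OF T] mult_left_mono[OF sqrt_le[OF T] C] by linarith
  show ?thesis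
    using YM BM AM by (intro exI[of _ "max M1 (max M2 (3 / 2 * M2 + G + C * sqrt (2 * M1)))"]) (auto simp: le_max_iff_disj)
qed

text \<open>A positive limit would force \<open>a\<close> eventually above \<open>L / 2\<close>
  times \<open>1 / (1 + t)\<close>, whose integrals grow logarithmically, against the bound
  \<open>M\<close>.\<close>

lemma tendsto_zero_of_integral_div_bounded:
  fixes Y a :: "real \<Rightarrow> real"
  assumes lim: "(Y \<longlongrightarrow> L) at_top" and t1: "0 \<le> t1"
    and Y: "\<And>t. t1 \<le> t \<Longrightarrow> 0 \<le> Y t" and a: "\<And>t. t1 \<le> t \<Longrightarrow> Y t / (1 + t) \<le> a t"
    and int: "\<And>s t. t1 \<le> s \<Longrightarrow> a integrable_on {s..t}" and bound: "\<And>t. t1 \<le> t \<Longrightarrow> integral {t1..t} a \<le> M"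
  shows "L = 0"
proof (rule ccontr)
  assume "L \<noteq> 0"
  moreover have "0 \<le> L"
    using lim Y by (intro tendsto_lowerbound[OF lim]) (auto intro: eventually_mono[OF eventually_ge_at_top[of t1]])
  ultimately have L: "0 < L" by simp
  then have "\<forall>\<^sub>F t in at_top. L / 2 < Y t"
    using order_tendstoD(1)[OF lim, of "L/2"] by simp
  then obtain t2 where t2: "\<And>t. t2 \<le> t \<Longrightarrow> L / 2 < Y t"
    by (auto simp: eventually_at_top_linorder)
  define s where "s = max t1 t2"
  have le: "L / 2 * (ln (1 + t) - ln (1 + s)) \<le> M" if st: "s \<le> t" for t
  proof -
    have "((\<lambda>r. 1 / (1 + r)) has_integral (ln (1 + t) - ln (1 + s))) {s..t}"
      using st t1 by (intro fundamental_theorem_of_calculus)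
        (auto simp: s_def has_real_derivative_iff_has_vector_derivative[symmetric] intro!: derivative_eq_intros)
    then have i: "((\<lambda>r. L / 2 * (1 / (1 + r))) has_integral (L / 2 * (ln (1 + t) - ln (1 + s)))) {s..t}"
      by (rule has_integral_mult_right)
    have "L / 2 * (ln (1 + t) - ln (1 + s)) \<le> integral {s..t} a"
    proof (rule has_integral_le[OF i integrable_integral])
      show "a integrable_on {s..t}"
        by (rule int) (simp add: s_def)
      fix r assume r: "r \<in> {s..t}"
      then have "L / 2 * (1 / (1 + r)) \<le> Y r / (1 + r)"
        using t2[of r] t1 divide_right_mono[of "L / 2" "Y r" "1 + r"] by (auto simp: s_def)
      also have "\<dots> \<le> a r"
        using r by (intro a) (auto simp: s_def)
      finally show "L / 2 * (1 / (1 + r)) \<le> a r" .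
    qed
    also have "\<dots> = integral {t1..t} a - integral {t1..s} a"
      using st by (intro integral_split_Icc int) (auto simp: s_def)
    also have "\<dots> \<le> M"
    proof -
      have "0 \<le> a r" if "r \<in> {t1..s}" for r
        using a[of r] Y[of r] that t1 by (smt (verit) atLeastAtMost_iff divide_nonneg_nonneg)
      then have "0 \<le> integral {t1..s} a"
        using int by (intro Henstock_Kurzweil_Integration.integral_nonneg) auto
      then show ?thesis
        using bound[of t] st by (simp add: s_def)
    qed
    finally show ?thesis .
  qed
  have "filterlim (\<lambda>t::real. 1 + t) at_top at_top"
    by (rule filterlim_tendsto_add_at_top[OF tendsto_const filterlim_ident])
  then have "filterlim (\<lambda>t::real. ln (1 + t)) at_top at_top"
    using filterlim_compose[OF ln_at_top] by blast
  then have "\<forall>\<^sub>F t::real in at_top. 2 * M / L + ln (1 + s) < ln (1 + t)"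
    by (simp add: filterlim_at_top_dense)
  then have "\<forall>\<^sub>F t::real in at_top. False"
    using eventually_ge_at_top[of s]
  proof eventually_elim
    case (elim t)
    then show ?case
      using le[of t] L by (simp add: field_simps)
  qed
  then show False by simp
qed

subsection \<open>Weak compactness and Opial's lemma\<close>

text \<open>A minimising sequence of \<open>x \<mapsto> \<parallel>x\<parallel>\<^sup>2 / 2 - \<phi> x\<close> is Cauchy by the parallelogram law.\<close>

lemma riesz_representation:
  fixes \<phi> :: "'v::{real_inner, complete_space} \<Rightarrow>\<^sub>L real"
  shows "\<exists>q. \<forall>x. \<phi> x = q \<bullet> x"
proof -
  define J where "J x = (norm x)\<^sup>2 / 2 - \<phi> x" for x
  define m where "m = Inf (range J)"
  have lb: "- (norm \<phi>)\<^sup>2 / 2 \<le> J x" for x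
  proof -
    have "\<phi> x \<le> norm \<phi> * norm x"
      using norm_blinfun[of \<phi> x] by simp
    also have "\<dots> \<le> ((norm \<phi>)\<^sup>2 + (norm x)\<^sup>2) / 2"
      using sum_squares_bound[of "norm \<phi>" "norm x"] by simp
    finally show ?thesis by (simp add: J_def field_simps)
  qed
  have m: "m \<le> J x" for x
    unfolding m_def using lb by (intro cInf_lower bdd_belowI[of _ "- (norm \<phi>)\<^sup>2 / 2"]) auto
  have "\<exists>x. J x < m + 1 / Suc n" for n
    using cInf_lessD[of "range J" "m + 1 / Suc n"] by (auto simp: m_def)
  then obtain x where x: "\<And>n. J (x n) < m + 1 / Suc n" by metis
  have par: "(norm (a - b))\<^sup>2 / 4 \<le> (J a - m) + (J b - m)" for a b
  proof -
    have "(norm (a - b))\<^sup>2 / 4 = J a + J b - 2 * J ((1/2) *\<^sub>R (a + b))"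
      by (simp add: J_def power2_norm_eq_inner blinfun.scaleR_right blinfun.add_right
          inner_add_left inner_add_right inner_diff_left inner_diff_right inner_commute field_simps)
    then show ?thesis using m[of "(1/2) *\<^sub>R (a + b)"] by simp
  qed
  have "Cauchy x"
  proof (rule metric_CauchyI)
    fix e :: real assume e: "0 < e"
    \<comment> \<open>Two defects below \<open>e^2 / 8\<close> add up to \<open>e^2 / 4\<close>, the
      quantity on the left of the parallelogram estimate.\<close>
    obtain N where N: "1 / Suc N < e\<^sup>2 / 8"
      using reals_Archimedean[of "e\<^sup>2 / 8"] e by (auto simp: inverse_eq_divide)
    have "dist (x i) (x j) < e" if "N \<le> i" "N \<le> j" for i j
    proof -
      have "J (x l) - m < e\<^sup>2 / 8" if "N \<le> l" for l
      proof -
        have "1 / real (Suc l) \<le> 1 / real (Suc N)"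
          using that by (intro divide_left_mono) auto
        then show ?thesis using x[of l] N by linarith
      qed
      from this[of i] this[of j] have "(norm (x i - x j))\<^sup>2 / 4 < e\<^sup>2 / 4"
        using par[of "x i" "x j"] that by simp
      then have "(norm (x i - x j))\<^sup>2 < e\<^sup>2" by simp
      then show ?thesis
        unfolding dist_norm by (rule power_less_imp_less_base) (use e in simp)
    qed
    then show "\<exists>M. \<forall>m\<ge>M. \<forall>n\<ge>M. dist (x m) (x n) < e" by blast
  qed
  then obtain q where q: "x \<longlonglongrightarrow> q"
    using Cauchy_convergent_iff convergent_def by blast
  have "(\<lambda>n. J (x n)) \<longlonglongrightarrow> J q"
    unfolding J_def by (intro tendsto_intros q) auto
  moreover have "(\<lambda>n. m + 1 / Suc n) \<longlonglongrightarrow> m + 0"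
    using LIMSEQ_Suc[OF lim_1_over_n] by (intro tendsto_intros) blast
  ultimately have Jq: "J q \<le> m"
    using x by (intro LIMSEQ_le[of "\<lambda>n. J (x n)" _ "\<lambda>n. m + 1 / Suc n"]) (auto intro: less_imp_le)
  have "\<phi> y = q \<bullet> y" for y
  proof -
    define c where "c = q \<bullet> y - \<phi> y"
    define n where "n = (norm y)\<^sup>2"
    \<comment> \<open>The optimal step in direction \<open>y\<close> is \<open>- c / n\<close>. The
      added 1 covers \<open>y = 0\<close>, and the step still strictly decreases \<open>J\<close>
      unless \<open>c = 0\<close>.\<close>
    define t where "t = - c / (1 + n)"
    have n: "0 \<le> n" by (simp add: n_def)
    have "J q \<le> J (q + t *\<^sub>R y)"
      using Jq m[of "q + t *\<^sub>R y"] by simp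
    also have "\<dots> = J q + t * c + t\<^sup>2 * n / 2"
      by (simp add: J_def n_def c_def power2_norm_eq_inner blinfun.scaleR_right blinfun.add_right
          inner_add_left inner_add_right inner_commute field_simps power2_eq_square[of t])
    finally have "0 \<le> t * c + t\<^sup>2 * n / 2"
      by simp
    also have "c = - t * (1 + n)"
      using n by (simp add: t_def)
    finally have "t\<^sup>2 * (1 + n / 2) \<le> 0"
      by (simp add: algebra_simps power2_eq_square)
    then have "t = 0"
      using n by (simp add: mult_le_0_iff)
    then have "c = 0"
      using n by (simp add: t_def)
    then show ?thesis by (simp add: c_def)
  qed
  then show ?thesis by blast
qed

text \<open>Weak compactness of balls by Tychonoff: the functionals
  \<open>x \<mapsto> u t \<bullet> x\<close> eventually lie in a product of compact intervals of
  radius \<open>M * norm x\<close>. A cluster point there is linear and bounded, being a pointwise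
  limit, and is therefore represented by a vector.\<close>

lemma bounded_imp_weakly_convergent_subfilter:
  fixes u :: "'a \<Rightarrow> 'v::{real_inner, complete_space}"
  assumes G: "G \<noteq> bot" and bounded: "eventually (\<lambda>t. norm (u t) \<le> M) G"
  shows "\<exists>v G'. G' \<le> G \<and> G' \<noteq> bot \<and> weakly_tendsto u v G'"
proof -
  define U where "U t = (\<lambda>x. u t \<bullet> x)" for t
  define S where "S = PiE UNIV (\<lambda>x::'v. cball (0::real) (M * norm x))"
  have "compactin (product_topology (\<lambda>_. euclidean) UNIV) S"
    unfolding S_def by (subst compactin_PiE) auto
  then have "compact S"
    by (simp add: euclidean_product_topology compactin_euclidean_iff)
  moreover have "filtermap U G \<noteq> bot"
    using G by (simp add: filtermap_bot_iff)
  moreover have "eventually (\<lambda>f. f \<in> S) (filtermap U G)"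
    unfolding eventually_filtermap using bounded
  proof eventually_elim
    case (elim t)
    have "\<bar>u t \<bullet> x\<bar> \<le> M * norm x" for x
      using Cauchy_Schwarz_ineq2[of "u t" x] mult_right_mono[OF elim, of "norm x"] by simp
    then show ?case by (auto simp: S_def U_def)
  qed
  ultimately obtain l where l: "inf (nhds l) (filtermap U G) \<noteq> bot"
    unfolding compact_filter by blast
  \<comment> \<open>Pulling the neighbourhoods of \<open>l\<close> back along \<open>U\<close> and
    meeting them with \<open>G\<close> turns the cluster point into a genuine limit along a finer
    filter.\<close>
  define G' where "G' = inf (filtercomap U (nhds l)) G"
  have G': "G' \<noteq> bot"
  proof
    assume "G' = bot"
    then have "eventually (\<lambda>_. False) G'" by simp
    then obtain Q R where QR: "eventually Q (filtercomap U (nhds l))" "eventually R G" "\<And>t. Q t \<Longrightarrow> R t \<Longrightarrow> False"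
      unfolding G'_def eventually_inf by blast
    then obtain P where P: "eventually P (nhds l)" "\<And>t. P (U t) \<Longrightarrow> Q t"
      unfolding eventually_filtercomap by blast
    have "eventually (\<lambda>f. \<not> P f) (filtermap U G)"
      unfolding eventually_filtermap using QR(2) by eventually_elim (use P QR in blast)
    with P(1) have "eventually (\<lambda>_. False) (inf (nhds l) (filtermap U G))"
      unfolding eventually_inf by blast
    with l show False by (simp add: trivial_limit_def)
  qed
  have "filterlim U (nhds l) (filtercomap U (nhds l))"
    by (rule filterlim_filtercomap)
  then have "filterlim U (nhds l) G'"
    by (rule filterlim_mono) (auto simp: G'_def)
  then have lim: "((\<lambda>t. u t \<bullet> x) \<longlongrightarrow> l x) G'" for x
    using continuous_on_tendsto_compose[OF continuous_on_product_coordinates[of x], of U l G'] by (simp add: U_def)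
  have "bounded_linear l"
  proof (rule bounded_linear_intro)
    show "l (x + y) = l x + l y" for x y
      using tendsto_unique[OF G' lim[of "x + y"]] tendsto_add[OF lim[of x] lim[of y]] by (simp add: inner_add_right)
    show "l (r *\<^sub>R x) = r *\<^sub>R l x" for r x
      using tendsto_unique[OF G' lim[of "r *\<^sub>R x"]] tendsto_mult_left[OF lim[of x]] by simp
    show "norm (l x) \<le> norm x * M" for x
    proof (rule tendsto_upperbound[OF tendsto_norm[OF lim] _ G'])
      have "eventually (\<lambda>t. norm (u t) \<le> M) G'"
        by (rule filter_leD[OF _ bounded]) (simp add: G'_def)
      then show "eventually (\<lambda>t. norm (u t \<bullet> x) \<le> norm x * M) G'"
      proof eventually_elim
        case (elim t)
        then show ?case
          using Cauchy_Schwarz_ineq2[of "u t" x] mult_right_mono[OF elim, of "norm x"] by (simp add: mult.commute)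
      qed
    qed
  qed
  then obtain q where q: "\<And>x. l x = q \<bullet> x"
    using riesz_representation[of "Blinfun l"] by (auto simp: bounded_linear_Blinfun_apply)
  have "weakly_tendsto u q G'"
    unfolding weakly_tendsto_def
  proof
    fix \<phi> :: "'v \<Rightarrow>\<^sub>L real"
    obtain p where "\<And>x. \<phi> x = p \<bullet> x"
      using riesz_representation[of \<phi>] by auto
    then show "((\<lambda>t. \<phi> (u t)) \<longlongrightarrow> \<phi> q) G'"
      using lim[of p] q[of p] by (simp add: inner_commute)
  qed
  with G' show ?thesis
    by (auto simp: G'_def intro!: exI[of _ q] exI[of _ G'])
qed

text \<open>The difference of the squared distances to two cluster points \<open>v\<close>,
  \<open>w\<close> is affine in \<open>\<iota> (u t) \<bullet> \<iota> (v - w)\<close>, so this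
  product has one limit along all of \<open>F\<close>. Evaluating it along filters leading to
  \<open>v\<close> and to \<open>w\<close> gives \<open>\<iota> (v - w) = 0\<close>. Distances are
  measured in the weaker space, and injectivity of \<open>\<iota>\<close> brings the conclusion
  back.\<close>

lemma opial_weakly_tendsto:
  fixes u :: "'a \<Rightarrow> 'v::{real_inner, complete_space}" and \<iota> :: "'v \<Rightarrow> 'h::real_inner"
  assumes F: "F \<noteq> bot" and bounded: "eventually (\<lambda>t. norm (u t) \<le> M) F"
    and \<iota>: "bounded_linear \<iota>" "inj \<iota>"
    and cluster: "\<And>v G. G \<le> F \<Longrightarrow> G \<noteq> bot \<Longrightarrow> weakly_tendsto u v G \<Longrightarrow> v \<in> S"
    and dist: "\<And>v. v \<in> S \<Longrightarrow> \<exists>L. ((\<lambda>t. (norm (\<iota> (u t) - \<iota> v))\<^sup>2) \<longlongrightarrow> L) F"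
  shows "\<exists>v\<in>S. weakly_tendsto u v F"
proof -
  interpret \<iota>: bounded_linear \<iota> by fact
  have unique: "v = w"
    if G: "G1 \<le> F" "G1 \<noteq> bot" "weakly_tendsto u v G1" "G2 \<le> F" "G2 \<noteq> bot" "weakly_tendsto u w G2" for v w G1 G2
  proof -
    have "v \<in> S" "w \<in> S"
      using G cluster by blast+
    then obtain L1 L2 where L: "((\<lambda>t. (norm (\<iota> (u t) - \<iota> v))\<^sup>2) \<longlongrightarrow> L1) F" "((\<lambda>t. (norm (\<iota> (u t) - \<iota> w))\<^sup>2) \<longlongrightarrow> L2) F"
      using dist by blast
    define c where "c = (L2 - L1 - (norm (\<iota> w))\<^sup>2 + (norm (\<iota> v))\<^sup>2) / 2"
    have "((\<lambda>t. ((norm (\<iota> (u t) - \<iota> w))\<^sup>2 - (norm (\<iota> (u t) - \<iota> v))\<^sup>2 - (norm (\<iota> w))\<^sup>2 + (norm (\<iota> v))\<^sup>2) / 2) \<longlongrightarrow> c) F"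
      unfolding c_def by (intro tendsto_intros L) simp
    moreover have "((norm (\<iota> (u t) - \<iota> w))\<^sup>2 - (norm (\<iota> (u t) - \<iota> v))\<^sup>2 - (norm (\<iota> w))\<^sup>2 + (norm (\<iota> v))\<^sup>2) / 2
        = \<iota> (u t) \<bullet> \<iota> (v - w)" for t
      by (simp add: power2_norm_eq_inner \<iota>.diff inner_diff_left inner_diff_right inner_commute field_simps)
    ultimately have lim: "((\<lambda>t. \<iota> (u t) \<bullet> \<iota> (v - w)) \<longlongrightarrow> c) F"
      by simp
    have "\<iota> x \<bullet> \<iota> (v - w) = c" if H: "H \<le> F" "H \<noteq> bot" "weakly_tendsto u x H" for x H
    proof -
      have "bounded_linear (\<lambda>x. \<iota> x \<bullet> \<iota> (v - w))"
        by (rule bounded_linear_compose[OF bounded_linear_inner_left \<iota>(1)])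
      then have "((\<lambda>t. \<iota> (u t) \<bullet> \<iota> (v - w)) \<longlongrightarrow> \<iota> x \<bullet> \<iota> (v - w)) H"
        using H(3) unfolding weakly_tendsto_def
        by (auto dest: spec[of _ "Blinfun (\<lambda>x. \<iota> x \<bullet> \<iota> (v - w))"] simp: bounded_linear_Blinfun_apply)
      then show ?thesis
        using tendsto_unique[OF H(2) _ tendsto_mono[OF H(1) lim]] by blast
    qed
    then have "\<iota> (v - w) \<bullet> \<iota> (v - w) = 0"
      using G by (simp add: \<iota>.diff inner_diff_left)
    then show ?thesis
      using \<iota>(2) \<iota>.zero by (simp add: \<iota>.diff inj_eq)
  qed
  obtain v G1 where G1: "G1 \<le> F" "G1 \<noteq> bot" "weakly_tendsto u v G1"
    using bounded_imp_weakly_convergent_subfilter[OF F bounded] by blast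
  have "weakly_tendsto u v F"
    unfolding weakly_tendsto_def
  proof (rule ccontr)
    assume "\<not> (\<forall>\<phi>::'v \<Rightarrow>\<^sub>L real. ((\<lambda>t. \<phi> (u t)) \<longlongrightarrow> \<phi> v) F)"
    then obtain \<phi> :: "'v \<Rightarrow>\<^sub>L real" and e where e: "e > 0" "\<not> eventually (\<lambda>t. dist (\<phi> (u t)) (\<phi> v) < e) F"
      unfolding tendsto_iff by blast
    \<comment> \<open>\<open>F\<close> restricted to the times at which convergence fails; a weak
      cluster point along it must again be \<open>v\<close>, yet stays at distance \<open>e\<close>
      under \<open>\<phi>\<close>.\<close>
    define G where "G = inf F (principal {t. e \<le> dist (\<phi> (u t)) (\<phi> v)})"
    have "G \<noteq> bot"
      using e(2) by (auto simp: G_def trivial_limit_def eventually_inf_principal not_le)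
    moreover have "G \<le> F"
      by (simp add: G_def)
    ultimately obtain w G2 where G2: "G2 \<le> G" "G2 \<noteq> bot" "weakly_tendsto u w G2"
      using bounded_imp_weakly_convergent_subfilter[of G u M] bounded filter_leD by blast
    then have "w = v"
      using unique[of G2 w G1 v] G1 \<open>G \<le> F\<close> by auto
    then have "((\<lambda>t. dist (\<phi> (u t)) (\<phi> v)) \<longlongrightarrow> dist (\<phi> v) (\<phi> v)) G2"
      using G2(3) unfolding weakly_tendsto_def by (intro tendsto_dist tendsto_const) auto
    moreover have "eventually (\<lambda>t. e \<le> dist (\<phi> (u t)) (\<phi> v)) G2"
      by (rule filter_leD[OF G2(1)]) (simp add: G_def eventually_inf_principal)
    ultimately have "e \<le> dist (\<phi> v) (\<phi> v)"
      using G2(2) by (intro tendsto_lowerbound)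
    then show False using e by simp
  qed
  moreover have "v \<in> S"
    using cluster G1 by blast
  ultimately show ?thesis by blast
qed

subsection \<open>The damped evolution equation\<close>

lemma W11_loc_deriv_increment_le:
  fixes X x n :: "real \<Rightarrow> real"
  assumes X: "W11_loc_deriv X x" and st: "0 \<le> s" "s \<le> t" and n: "n integrable_on {s..t}"
    and le: "AE r in lebesgue. s \<le> r \<longrightarrow> r \<le> t \<longrightarrow> x r \<le> n r"
  shows "X t - X s \<le> integral {s..t} n"
proof -
  obtain N where N: "N \<in> null_sets lebesgue" "\<And>r. r \<notin> N \<Longrightarrow> s \<le> r \<longrightarrow> r \<le> t \<longrightarrow> x r \<le> n r"
    using le by (auto elim!: AE_E3)
  \<comment> \<open>On the exceptional null set the density is replaced by \<open>n\<close> itself: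
    the integral is unchanged and the comparison becomes pointwise.\<close>
  have "((\<lambda>r. if r \<in> N then n r else x r) has_integral (X t - X s)) {s..t}"
    using N(1) by (intro has_integral_spike[OF _ _ W11_loc_deriv_has_integral[OF X st], of N])
      (auto simp: negligible_iff_null_sets)
  then show ?thesis
    by (rule has_integral_le[OF _ integrable_integral[OF n]]) (use N(2) in auto)
qed

text \<open>On the line through \<open>v\<close> and \<open>w\<close> this is the tangent inequality
  for a convex function of one real variable with slope \<open>F' (w - v)\<close> at 0.\<close>

lemma convex_on_above_tangent:
  fixes F :: "'v::real_normed_vector \<Rightarrow> real"
  assumes F: "convex_on UNIV F" and deriv: "(F has_derivative F') (at v)"
  shows "F v + F' (w - v) \<le> F w"
proof -
  interpret F': bounded_linear F'
    using deriv by (rule has_derivative_bounded_linear)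
  define \<psi> where "\<psi> r = F (v + r *\<^sub>R (w - v))" for r :: real
  have "convex_on UNIV \<psi>"
  proof (rule convex_onI)
    fix t x y :: real assume "0 < t" "t < 1"
    have "v + ((1 - t) *\<^sub>R x + t *\<^sub>R y) *\<^sub>R (w - v) = (1 - t) *\<^sub>R (v + x *\<^sub>R (w - v)) + t *\<^sub>R (v + y *\<^sub>R (w - v))"
      by (simp add: algebra_simps)
    then show "\<psi> ((1 - t) *\<^sub>R x + t *\<^sub>R y) \<le> (1 - t) * \<psi> x + t * \<psi> y"
      unfolding \<psi>_def using convex_onD[OF F, of t] \<open>0 < t\<close> \<open>t < 1\<close> by simp
  qed auto
  moreover have "(\<psi> has_field_derivative F' (w - v)) (at 0)"
  proof -
    have "((\<lambda>r. v + r *\<^sub>R (w - v)) has_derivative (\<lambda>r. r *\<^sub>R (w - v))) (at 0)"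
      by (auto intro!: derivative_eq_intros)
    then have "(\<psi> has_derivative (\<lambda>r. F' (r *\<^sub>R (w - v)))) (at 0)"
      unfolding \<psi>_def using deriv by (intro has_derivative_compose[of _ _ 0 UNIV F F', simplified]) simp_all
    then show ?thesis
      by (simp add: has_field_derivative_def F'.scaleR mult_commute_abs)
  qed
  ultimately have "F' (w - v) * (1 - 0) \<le> \<psi> 1 - \<psi> 0"
    by (intro convex_on_imp_above_tangent[of UNIV]) auto
  then show ?thesis by (simp add: \<psi>_def)
qed

text \<open>The existential hypotheses of the theorem enter with fixed witnesses: \<open>d\<close>
  for the derivative of the weighted damping, \<open>w\<close> for the \<open>V\<close>-valued
  derivative of \<open>u\<close>, and \<open>C\<^sub>0\<close> for the bound in
  \<open>H\<close>.\<close>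

locale damped_equation =
  fixes \<iota> :: "'v::{real_inner, complete_space} \<Rightarrow> 'h::{real_inner, complete_space}"
    and \<alpha> K t\<^sub>0 lam \<mu> C\<^sub>0 :: real
    and \<gamma> d :: "real \<Rightarrow> real"
    and A f :: "'v \<Rightarrow> 'v \<Rightarrow>\<^sub>L real"
    and F :: "'v \<Rightarrow> real"
    and g :: "real \<Rightarrow> 'h"
    and u w :: "real \<Rightarrow> 'v"
    and u' u'' :: "real \<Rightarrow> 'h"
  assumes embedding: "dense_embedding \<iota>"
    and alpha: "0 \<le> \<alpha>" "\<alpha> < 1"
    and K: "0 < K"
    and t0: "0 \<le> t\<^sub>0"
    and gamma_lower: "\<And>t. t\<^sub>0 \<le> t \<Longrightarrow> K / (1 + t) powr \<alpha> \<le> \<gamma> t"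
    and gamma_deriv: "W11_loc_deriv (\<lambda>t. (1 + t) powr \<alpha> * \<gamma> t) d"
    and gamma_decr: "AE t in lebesgue. t\<^sub>0 \<le> t \<longrightarrow> d t \<le> 0"
    and A_linear: "bounded_linear A"
    and A_symmetric: "\<And>v w. A v w = A w v"
    and A_positive: "\<And>v. 0 \<le> A v v"
    and lambda: "0 \<le> lam"
    and mu: "0 < \<mu>"
    and A_coercive: "\<And>v. \<mu> * (norm v)\<^sup>2 \<le> A v v + lam * (norm (\<iota> v))\<^sup>2"
    and f_continuous: "continuous_on UNIV f"
    and F_convex: "convex_on UNIV F"
    and F_derivative: "\<And>v. (F has_derivative f v) (at v)"
    and argmin_nonempty: "argmin (potential A F) \<noteq> {}"
    and g_weighted: "set_integrable lebesgue {0..} (\<lambda>t. (1 + t) powr \<alpha> * norm (g t))"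
    and u_deriv: "W11_loc_deriv (\<lambda>t. \<iota> (u t)) u'"
    and u'_deriv: "W11_loc_deriv u' u''"
    and u_deriv_V: "W11_loc_deriv u w"
    and equation: "AE t in lebesgue. 0 \<le> t \<longrightarrow>
                     to_dual \<iota> (u'' t) + \<gamma> t *\<^sub>R to_dual \<iota> (u' t) + A (u t) + f (u t)
                       = to_dual \<iota> (g t)"
    and u_bounded: "AE t in lebesgue. 0 \<le> t \<longrightarrow> norm (\<iota> (u t)) \<le> C\<^sub>0"
begin

abbreviation "\<Phi> \<equiv> potential A F"
abbreviation "E \<equiv> energy \<Phi> u u'"

definition "D\<Phi> v = A v + f v"
definition "h t = (1 + t) powr \<alpha>"
definition "h' t = \<alpha> * (1 + t) powr (\<alpha> - 1)"
definition "h'' t = \<alpha> * (\<alpha> - 1) * (1 + t) powr (\<alpha> - 2)"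
definition "p t = h t * \<gamma> t"
definition "Y t = (h t)\<^sup>2 * E t"

sublocale A: bounded_linear A by (rule A_linear)

sublocale \<iota>: bounded_linear \<iota>
  using embedding by (simp add: dense_embedding_def)

section \<open>Convexity of the potential and the energy identity\<close>

lemma potential_has_derivative: "(\<Phi> has_derivative D\<Phi> v) (at v)"
proof -
  have "((\<lambda>v. A v v) has_derivative (\<lambda>x. A v x + A x v)) (at v)"
    by (rule blinfun.FDERIV[OF A.has_derivative[OF has_derivative_ident] has_derivative_ident])
  from has_derivative_add[OF has_derivative_mult_right[OF this, of "1/2"] F_derivative[of v]]
  show ?thesis
    unfolding potential_def[abs_def] D\<Phi>_def blinfun.add_left[abs_def] by (simp add: A_symmetric[of _ v])
qed

lemma D_potential_continuous: "continuous_on UNIV D\<Phi>"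
  unfolding D\<Phi>_def by (intro continuous_intros f_continuous A.continuous_on)

text \<open>\<open>F\<close> contributes its tangent inequality, while the quadratic form is
  expanded exactly. The leftover quadratic term is kept because, at a minimiser, it is what bounds
  the trajectory in \<open>V\<close>.\<close>

lemma potential_above_tangent:
  "\<Phi> v + D\<Phi> v (x - v) + 1 / 2 * A (x - v) (x - v) \<le> \<Phi> x"
  using convex_on_above_tangent[OF F_convex F_derivative, of v x] A_symmetric[of x v]
  by (simp add: potential_def D\<Phi>_def blinfun.add_left blinfun.diff_right A.diff blinfun.diff_left algebra_simps)

lemma argmin_le: "x \<in> argmin \<Phi> \<Longrightarrow> \<Phi> x \<le> \<Phi> v"
  by (auto simp: argmin_def is_arg_min_def not_less)

lemma argmin_D_potential: "x \<in> argmin \<Phi> \<Longrightarrow> D\<Phi> x v = 0"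
  using has_derivative_local_min[OF potential_has_derivative[of x]] argmin_le[of x] by simp

lemma energy_eq: "x \<in> argmin \<Phi> \<Longrightarrow> E t = (norm (u' t))\<^sup>2 / 2 + (\<Phi> (u t) - \<Phi> x)"
proof -
  assume x: "x \<in> argmin \<Phi>"
  then have "(INF v. \<Phi> v) = \<Phi> x"
    using argmin_le by (intro cInf_eq_minimum) auto
  then show ?thesis by (simp add: energy_def)
qed

lemma kinetic_le_energy: "(norm (u' t))\<^sup>2 \<le> 2 * E t"
  using argmin_nonempty energy_eq[of _ t] argmin_le[of _ "u t"] by fastforce

lemma energy_nonneg: "0 \<le> E t"
  using kinetic_le_energy[of t] zero_le_power2[of "norm (u' t)"] by linarith

text \<open>One null set serves all \<open>v\<close> at once; this matters because the test vectors
  used later, \<open>w t\<close> and \<open>u t - x\<close>, vary with \<open>t\<close>.\<close>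

lemma equation_apply:
  "AE t in lebesgue. 0 \<le> t \<longrightarrow> (\<forall>v. u'' t \<bullet> \<iota> v + \<gamma> t * (u' t \<bullet> \<iota> v) + D\<Phi> (u t) v = g t \<bullet> \<iota> v)"
  using equation
proof eventually_elim
  case (elim t)
  have "blinfun_apply (to_dual \<iota> (u'' t) + \<gamma> t *\<^sub>R to_dual \<iota> (u' t) + A (u t) + f (u t)) v
    = u'' t \<bullet> \<iota> v + \<gamma> t * (u' t \<bullet> \<iota> v) + D\<Phi> (u t) v" for v
    by (simp add: blinfun.add_left blinfun.scaleR_left to_dual_apply[OF embedding] D\<Phi>_def)
  then show ?case
    using elim to_dual_apply[OF embedding, of "g t"] by metis
qed

text \<open>Pairing the equation with the \<open>V\<close>-valued derivative \<open>w\<close> is legitimate, and \<open>\<iota> (w t)\<close> agrees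
  with \<open>u' t\<close> almost everywhere.\<close>

lemma energy_deriv: "W11_loc_deriv E (\<lambda>t. g t \<bullet> u' t - \<gamma> t * (norm (u' t))\<^sup>2)"
proof (rule W11_loc_deriv_cong_AE)
  obtain x where x: "x \<in> argmin \<Phi>"
    using argmin_nonempty by auto
  have "W11_loc_deriv (\<lambda>t. 1 / 2 * (u' t \<bullet> u' t) + \<Phi> (u t) - \<Phi> x)
    (\<lambda>t. 1 / 2 * (u' t \<bullet> u'' t + u'' t \<bullet> u' t) + D\<Phi> (u t) (w t) - 0)"
    by (intro W11_loc_deriv_add W11_loc_deriv_diff W11_loc_deriv_const
        W11_loc_deriv_bounded_linear[OF bounded_linear_mult_right] W11_loc_deriv_inner u'_deriv
        W11_loc_deriv_chain[OF u_deriv_V potential_has_derivative D_potential_continuous])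
  then show "W11_loc_deriv E (\<lambda>t. u' t \<bullet> u'' t + D\<Phi> (u t) (w t))"
    by (simp add: energy_eq[OF x, abs_def] power2_norm_eq_inner inner_commute add_diff_eq)
  have "W11_loc_deriv (\<lambda>t. \<iota> (u t)) (\<lambda>t. \<iota> (w t))"
    by (rule W11_loc_deriv_bounded_linear[OF \<iota>.bounded_linear_axioms u_deriv_V])
  from W11_loc_deriv_unique[OF this u_deriv] equation_apply
  show "AE t in lebesgue. 0 \<le> t \<longrightarrow>
      u' t \<bullet> u'' t + D\<Phi> (u t) (w t) = g t \<bullet> u' t - \<gamma> t * (norm (u' t))\<^sup>2"
  proof eventually_elim
    case (elim t)
    show ?case
    proof
      assume t: "0 \<le> t"
      then have "u'' t \<bullet> u' t + \<gamma> t * (u' t \<bullet> u' t) + D\<Phi> (u t) (w t) = g t \<bullet> u' t"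
        using elim by metis
      then show "u' t \<bullet> u'' t + D\<Phi> (u t) (w t) = g t \<bullet> u' t - \<gamma> t * (norm (u' t))\<^sup>2"
        by (simp add: power2_norm_eq_inner inner_commute)
    qed
  qed
qed

section \<open>The weight \<open>h\<close> and the weighted damping \<open>p\<close>\<close>

lemma h_continuous: "continuous_on {0..} h" "continuous_on {0..} h'" "continuous_on {0..} h''"
  unfolding h_def h'_def h''_def by (intro continuous_intros; auto)+

lemma h_deriv: "W11_loc_deriv h h'" "W11_loc_deriv h' h''"
proof (rule W11_loc_deriv_C1)
  show "(h has_real_derivative h' t) (at t)" if "0 \<le> t" for t
    unfolding h_def h'_def using that by (auto intro!: derivative_eq_intros)
  show "W11_loc_deriv h' h''"
  proof (rule W11_loc_deriv_C1)
    show "(h' has_real_derivative h'' t) (at t)" if "0 \<le> t" for t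
      unfolding h'_def h''_def using that
      by (auto intro!: derivative_eq_intros simp: algebra_simps)
  qed (rule h_continuous)
qed (rule h_continuous)

lemma h_ge_1: "0 \<le> t \<Longrightarrow> 1 \<le> h t"
  unfolding h_def using alpha by (intro ge_one_powr_ge_zero) auto

lemma h_le: "0 \<le> t \<Longrightarrow> h t \<le> 1 + t"
  unfolding h_def using alpha powr_mono[of \<alpha> 1 "1 + t"] by simp

lemma h'_nonneg: "0 \<le> t \<Longrightarrow> 0 \<le> h' t" and h''_nonpos: "0 \<le> t \<Longrightarrow> h'' t \<le> 0"
  using alpha by (auto simp: h'_def h''_def mult_nonneg_nonpos mult_nonpos_nonneg)

lemma h'_tendsto: "(h' \<longlongrightarrow> 0) at_top"
proof -
  have "filterlim (\<lambda>t::real. 1 + t) at_top at_top"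
    by (rule filterlim_tendsto_add_at_top[OF tendsto_const filterlim_ident])
  then have "((\<lambda>t. \<alpha> * (1 + t) powr (\<alpha> - 1)) \<longlongrightarrow> \<alpha> * 0) at_top"
    using alpha by (intro tendsto_intros tendsto_neg_powr) auto
  then show ?thesis by (simp add: h'_def[abs_def])
qed

lemma p_deriv: "W11_loc_deriv p d"
  using gamma_deriv by (simp add: p_def[abs_def] h_def)

lemma p_ge: "t\<^sub>0 \<le> t \<Longrightarrow> K \<le> p t"
  using gamma_lower[of t] t0 by (simp add: p_def h_def field_simps)

lemma p_antimono: "t\<^sub>0 \<le> s \<Longrightarrow> s \<le> t \<Longrightarrow> p t \<le> p s"
proof -
  assume st: "t\<^sub>0 \<le> s" "s \<le> t"
  have "AE r in lebesgue. s \<le> r \<longrightarrow> r \<le> t \<longrightarrow> d r \<le> 0"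
    using gamma_decr by eventually_elim (use st in auto)
  then show ?thesis
    using W11_loc_deriv_increment_le[OF p_deriv, of s t "\<lambda>_. 0"] t0 st by (simp add: integrable_0)
qed

lemma energy_continuous: "continuous_on {0..} E"
  using energy_deriv by (rule W11_loc_deriv_continuous_on)

lemma u'_continuous: "continuous_on {0..} u'"
  using u'_deriv by (rule W11_loc_deriv_continuous_on)

section \<open>Increment inequalities for \<open>Y\<close> and \<open>Z\<close>\<close>

lemma Y_nonneg: "0 \<le> Y t"
  by (simp add: Y_def energy_nonneg)

lemma h_u'_le: "0 \<le> t \<Longrightarrow> h t * norm (u' t) \<le> sqrt (2 * Y t)"
proof (rule real_le_rsqrt)
  show "(h t * norm (u' t))\<^sup>2 \<le> 2 * Y t"
    using kinetic_le_energy[of t] mult_left_mono[of "(norm (u' t))\<^sup>2" "2 * E t" "(h t)\<^sup>2"]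
    by (simp add: Y_def power_mult_distrib)
qed

lemma energy_le_Y: "0 \<le> t \<Longrightarrow> E t \<le> Y t"
  using h_ge_1[of t] energy_nonneg[of t] mult_right_mono[of 1 "(h t)\<^sup>2" "E t"]
  by (simp add: Y_def one_le_power)

text \<open>In the damping term one factor of the weight \<open>h^2\<close> turns
  \<open>\<gamma>\<close> into \<open>p \<ge> K\<close>. In the source term one factor goes to
  \<open>h |u'| \<le> sqrt (2 Y) \<le> R\<close>, so that \<open>g\<close> appears only with its
  integrable weight \<open>h\<close>. The derivative of the weight is absorbed by
  \<open>small\<close>.\<close>

lemma Y_increment:
  assumes t1: "t\<^sub>0 \<le> s" "s \<le> t" and small: "\<And>r. s \<le> r \<Longrightarrow> 2 * h' r \<le> K / 3"
    and R: "\<And>r. s \<le> r \<Longrightarrow> r \<le> t \<Longrightarrow> sqrt (2 * Y r) \<le> R"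
    and int: "(\<lambda>r. K / 3 * (h r * E r) - K * (h r * (norm (u' r))\<^sup>2) + R * (h r * norm (g r))) integrable_on {s..t}"
  shows "Y t - Y s \<le> integral {s..t} (\<lambda>r. K / 3 * (h r * E r) - K * (h r * (norm (u' r))\<^sup>2) + R * (h r * norm (g r)))"
proof (rule W11_loc_deriv_increment_le[OF _ _ _ int])
  have "W11_loc_deriv (\<lambda>t. h t * h t * E t)
    (\<lambda>t. h t * h t * (g t \<bullet> u' t - \<gamma> t * (norm (u' t))\<^sup>2) + (h t * h' t + h' t * h t) * E t)"
    by (intro W11_loc_deriv_mult h_deriv energy_deriv)
  then show "W11_loc_deriv Y
    (\<lambda>t. h t * h t * (g t \<bullet> u' t - \<gamma> t * (norm (u' t))\<^sup>2) + (h t * h' t + h' t * h t) * E t)"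
    by (simp add: Y_def[abs_def] power2_eq_square)
  show "AE r in lebesgue. s \<le> r \<longrightarrow> r \<le> t \<longrightarrow>
    h r * h r * (g r \<bullet> u' r - \<gamma> r * (norm (u' r))\<^sup>2) + (h r * h' r + h' r * h r) * E r
    \<le> K / 3 * (h r * E r) - K * (h r * (norm (u' r))\<^sup>2) + R * (h r * norm (g r))"
  proof (intro AE_I2 impI)
    fix r assume r: "s \<le> r" "r \<le> t"
    then have r0: "0 \<le> r" "t\<^sub>0 \<le> r" using t0 t1 by auto
    then have h0: "0 \<le> h r" using h_ge_1[of r] by simp
    have "h r * h r * (g r \<bullet> u' r) \<le> h r * h r * (norm (g r) * norm (u' r))"
      by (intro mult_left_mono norm_cauchy_schwarz) (use h0 in auto)
    also have "\<dots> = (h r * norm (u' r)) * (h r * norm (g r))"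
      by simp
    also have "\<dots> \<le> R * (h r * norm (g r))"
      using h_u'_le[OF r0(1)] R[OF r] h0 by (intro mult_right_mono) auto
    finally have 1: "h r * h r * (g r \<bullet> u' r) \<le> R * (h r * norm (g r))" .
    have 2: "K * (h r * (norm (u' r))\<^sup>2) \<le> p r * (h r * (norm (u' r))\<^sup>2)"
      using p_ge[OF r0(2)] h0 by (intro mult_right_mono) auto
    have 3: "(2 * h' r) * (h r * E r) \<le> K / 3 * (h r * E r)"
      using small[OF r(1)] h0 energy_nonneg by (intro mult_right_mono) auto
    show "h r * h r * (g r \<bullet> u' r - \<gamma> r * (norm (u' r))\<^sup>2) + (h r * h' r + h' r * h r) * E r
      \<le> K / 3 * (h r * E r) - K * (h r * (norm (u' r))\<^sup>2) + R * (h r * norm (g r))"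
      using 1 2 3 by (simp add: p_def algebra_simps)
  qed
qed (use t0 t1 in auto)

text \<open>\<open>Z\<close> is \<open>h \<phi>' + p \<phi> - h' \<phi>\<close> for \<open>\<phi> = |u - x|\<^sup>2 / 2\<close>: up to the sign-definite terms in
  \<open>p'\<close> and \<open>h''\<close>, its derivative is \<open>h (\<phi>'' + \<gamma> \<phi>')\<close>.\<close>

definition "Z x t = h t * ((\<iota> (u t) - \<iota> x) \<bullet> u' t) + (p t - h' t) * (1 / 2 * (norm (\<iota> (u t) - \<iota> x))\<^sup>2)"

text \<open>The 3/2 arises because \<open>|u'|^2 - (\<Phi> u - \<Phi> x)\<close> equals
  \<open>3/2 |u'|^2 - E\<close>; convexity replaces the pairing of \<open>D\<Phi> u\<close> with
  \<open>u - x\<close> by the potential gap. The term with \<open>d\<close> is dropped by its sign,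
  whereas \<open>- h'' |u - x|^2 / 2\<close> has the wrong sign and is estimated by
  \<open>C\<close>.\<close>

lemma Z_increment:
  assumes x: "x \<in> argmin \<Phi>" and t1: "t\<^sub>0 \<le> s" "s \<le> t"
    and C: "\<And>r. s \<le> r \<Longrightarrow> norm (\<iota> (u r) - \<iota> x) \<le> C"
    and int: "(\<lambda>r. 3 / 2 * (h r * (norm (u' r))\<^sup>2) - h r * E r + (C * (h r * norm (g r)) - h'' r * C\<^sup>2 / 2)) integrable_on {s..t}"
  shows "Z x t - Z x s \<le> integral {s..t} (\<lambda>r. 3 / 2 * (h r * (norm (u' r))\<^sup>2) - h r * E r + (C * (h r * norm (g r)) - h'' r * C\<^sup>2 / 2))"
proof (rule W11_loc_deriv_increment_le[OF _ _ _ int])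
  define y where "y t = \<iota> (u t) - \<iota> x" for t
  have y: "W11_loc_deriv y u'"
    using W11_loc_deriv_diff[OF u_deriv W11_loc_deriv_const[of "\<iota> x"]] by (simp add: y_def[abs_def])
  define z where "z t = h t * (y t \<bullet> u'' t + u' t \<bullet> u' t) + h' t * (y t \<bullet> u' t) +
      ((p t - h' t) * (1 / 2 * (y t \<bullet> u' t + u' t \<bullet> y t)) + (d t - h'' t) * (1 / 2 * (y t \<bullet> y t)))" for t
  have "W11_loc_deriv (\<lambda>t. h t * (y t \<bullet> u' t) + (p t - h' t) * (1 / 2 * (y t \<bullet> y t))) z"
    unfolding z_def[abs_def]
    by (intro W11_loc_deriv_add W11_loc_deriv_diff W11_loc_deriv_mult
        W11_loc_deriv_bounded_linear[OF bounded_linear_mult_right] W11_loc_deriv_inner y u'_deriv h_deriv p_deriv)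
  then show "W11_loc_deriv (Z x) z"
    by (simp add: Z_def[abs_def] y_def power2_norm_eq_inner)
  show "AE r in lebesgue. s \<le> r \<longrightarrow> r \<le> t \<longrightarrow>
    z r \<le> 3 / 2 * (h r * (norm (u' r))\<^sup>2) - h r * E r + (C * (h r * norm (g r)) - h'' r * C\<^sup>2 / 2)"
    using equation_apply gamma_decr
  proof eventually_elim
    case (elim r)
    show ?case
    proof (intro impI)
      assume r: "s \<le> r" "r \<le> t"
      then have r0: "0 \<le> r" "t\<^sub>0 \<le> r" using t0 t1 by auto
      then have h0: "0 \<le> h r" using h_ge_1[of r] by simp
      have yC: "norm (y r) \<le> C"
        using C[OF r(1)] by (simp add: y_def)
      have eq: "u'' r \<bullet> y r + \<gamma> r * (u' r \<bullet> y r) + D\<Phi> (u r) (u r - x) = g r \<bullet> y r"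
        using elim(1) r0 unfolding y_def \<iota>.diff[symmetric] by blast
      have conv: "\<Phi> (u r) - \<Phi> x \<le> D\<Phi> (u r) (u r - x)"
        using potential_above_tangent[of "u r" x] A_positive[of "x - u r"] by (simp add: blinfun.diff_right[of "D\<Phi> (u r)"])
      have "g r \<bullet> y r \<le> norm (g r) * norm (y r)"
        by (rule norm_cauchy_schwarz)
      also have "\<dots> \<le> norm (g r) * C"
        using yC by (intro mult_left_mono) auto
      finally have "y r \<bullet> u'' r + u' r \<bullet> u' r + \<gamma> r * (y r \<bullet> u' r)
          \<le> 3 / 2 * (norm (u' r))\<^sup>2 - E r + C * norm (g r)"
        using eq conv by (simp add: energy_eq[OF x] power2_norm_eq_inner inner_commute mult.commute)
      then have 1: "h r * (y r \<bullet> u'' r + u' r \<bullet> u' r + \<gamma> r * (y r \<bullet> u' r))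
          \<le> h r * (3 / 2 * (norm (u' r))\<^sup>2 - E r + C * norm (g r))"
        using h0 by (rule mult_left_mono)
      have 2: "d r * (y r \<bullet> y r) \<le> 0"
        using elim(2) r0 by (intro mult_nonpos_nonneg) auto
      have "(norm (y r))\<^sup>2 \<le> C\<^sup>2"
        using yC by (intro power_mono) auto
      then have 3: "h'' r * C\<^sup>2 \<le> h'' r * (y r \<bullet> y r)"
        using h''_nonpos[OF r0(1)] by (simp add: power2_norm_eq_inner mult_left_mono_neg)
      show "z r \<le> 3 / 2 * (h r * (norm (u' r))\<^sup>2) - h r * E r + (C * (h r * norm (g r)) - h'' r * C\<^sup>2 / 2)"
        using 1 2 3 by (simp add: z_def p_def inner_commute[of "u' r" "y r"] algebra_simps diff_divide_distrib)
    qed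
  qed
qed (use t0 t1 in auto)

lemma weighted_source_integrable:
  assumes "0 \<le> s"
  shows "(\<lambda>r. h r * norm (g r)) integrable_on {s..t}" "integral {s..t} (\<lambda>r. h r * norm (g r)) \<le> integral {0..} (\<lambda>r. h r * norm (g r))"
proof -
  have a: "(\<lambda>r. h r * norm (g r)) absolutely_integrable_on {0..}"
    using g_weighted by (simp add: h_def)
  then have "(\<lambda>r. h r * norm (g r)) absolutely_integrable_on {s..t}"
    by (rule absolutely_integrable_on_subinterval) (use assms in auto)
  with a have i: "(\<lambda>r. h r * norm (g r)) integrable_on {0..}" "(\<lambda>r. h r * norm (g r)) integrable_on {s..t}"
    by (auto intro: set_lebesgue_integral_eq_integral(1))
  then show "(\<lambda>r. h r * norm (g r)) integrable_on {s..t}" by simp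
  show "integral {s..t} (\<lambda>r. h r * norm (g r)) \<le> integral {0..} (\<lambda>r. h r * norm (g r))"
  proof (intro integral_subset_le i ballI)
    show "0 \<le> h r * norm (g r)" if "r \<in> {0..}" for r
      using h_ge_1[of r] that by simp
  qed (use assms in auto)
qed

lemma weighted_integrable:
  assumes "0 \<le> s"
  shows "(\<lambda>r. h r * E r) integrable_on {s..t}" "(\<lambda>r. h r * (norm (u' r))\<^sup>2) integrable_on {s..t}"
    "h'' integrable_on {s..t}"
proof -
  have *: "continuous_on {s..t} h" "continuous_on {s..t} h''" "continuous_on {s..t} E" "continuous_on {s..t} u'"
    using assms by (auto intro: continuous_on_subset[OF h_continuous(1)] continuous_on_subset[OF h_continuous(3)]
        continuous_on_subset[OF energy_continuous] continuous_on_subset[OF u'_continuous])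
  show "(\<lambda>r. h r * E r) integrable_on {s..t}" "(\<lambda>r. h r * (norm (u' r))\<^sup>2) integrable_on {s..t}"
      "h'' integrable_on {s..t}"
    by (intro integrable_continuous_real continuous_intros *)+
qed

lemma distance_bounded: "1 \<le> t \<Longrightarrow> norm (\<iota> (u t) - \<iota> x) \<le> C\<^sub>0 + norm (\<iota> x)"
proof -
  assume t: "1 \<le> t"
  have "continuous_on {0..} (\<lambda>t. norm (\<iota> (u t)))"
    by (intro continuous_intros W11_loc_deriv_continuous_on[OF u_deriv])
  then have "norm (\<iota> (u t)) \<le> C\<^sub>0"
    using u_bounded by (rule AE_imp_bounded_of_continuous) (use t in simp)
  then show ?thesis
    using norm_triangle_ineq4[of "\<iota> (u t)" "\<iota> x"] by linarith
qed

text \<open>The contribution of \<open>- h''\<close> is nonnegative but integrates to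
  \<open>h' s - h' t\<close>, hence to at most \<open>h' s\<close>; the bound is therefore uniform
  in \<open>t\<close>.\<close>

lemma Z_remainder_integral_le:
  assumes "0 \<le> C" "0 \<le> s" "s \<le> t"
  shows "integral {s..t} (\<lambda>r. C * (h r * norm (g r)) - h'' r * C\<^sup>2 / 2)
    \<le> C * integral {0..} (\<lambda>r. h r * norm (g r)) + h' s * C\<^sup>2 / 2"
proof -
  have "((\<lambda>r. C * (h r * norm (g r)) - h'' r * C\<^sup>2 / 2) has_integral
    (C * integral {s..t} (\<lambda>r. h r * norm (g r)) - (h' t - h' s) * C\<^sup>2 / 2)) {s..t}"
    using assms W11_loc_deriv_has_integral[OF h_deriv(2), of s t]
    by (intro has_integral_diff has_integral_mult_right has_integral_divide has_integral_mult_left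
        integrable_integral weighted_source_integrable) auto
  then have "integral {s..t} (\<lambda>r. C * (h r * norm (g r)) - h'' r * C\<^sup>2 / 2) =
    C * integral {s..t} (\<lambda>r. h r * norm (g r)) - (h' t - h' s) * C\<^sup>2 / 2"
    by (rule integral_unique)
  also have "\<dots> \<le> C * integral {0..} (\<lambda>r. h r * norm (g r)) + h' s * C\<^sup>2 / 2"
    using mult_left_mono[OF weighted_source_integrable(2)[OF assms(2), of t] assms(1)]
      mult_right_mono[OF h'_nonneg[of t], of "C\<^sup>2"] assms
    by (simp add: algebra_simps diff_divide_distrib)
  finally show ?thesis .
qed

lemma cross_term_le:
  assumes "norm (\<iota> (u t) - \<iota> x) \<le> C" "0 \<le> t"
  shows "\<bar>h t * ((\<iota> (u t) - \<iota> x) \<bullet> u' t)\<bar> \<le> C * sqrt (2 * Y t)"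
proof -
  have h0: "0 \<le> h t" using h_ge_1[OF assms(2)] by simp
  have "\<bar>h t * ((\<iota> (u t) - \<iota> x) \<bullet> u' t)\<bar> \<le> h t * (norm (\<iota> (u t) - \<iota> x) * norm (u' t))"
    using h0 Cauchy_Schwarz_ineq2[of "\<iota> (u t) - \<iota> x" "u' t"] by (simp add: abs_mult mult_left_mono)
  also have "\<dots> = norm (\<iota> (u t) - \<iota> x) * (h t * norm (u' t))"
    by simp
  also have "\<dots> \<le> C * sqrt (2 * Y t)"
  proof (rule mult_mono)
    show "0 \<le> C"
      using assms(1) by (rule order_trans[OF norm_ge_zero])
  qed (use assms h_u'_le[OF assms(2)] h0 in auto)
  finally show ?thesis .
qed

text \<open>The condition \<open>1 \<le> t\<^sub>1\<close> is there because the essential bound on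
  \<open>u\<close> in \<open>H\<close> has been made pointwise only for times from 1 on.\<close>

definition "late t\<^sub>1 \<longleftrightarrow> t\<^sub>0 \<le> t\<^sub>1 \<and> 1 \<le> t\<^sub>1 \<and> (\<forall>r\<ge>t\<^sub>1. 2 * h' r \<le> K / 3)"

lemma late_exists: "\<exists>t\<^sub>1. late t\<^sub>1"
proof -
  have "\<forall>\<^sub>F r in at_top. h' r < K / 6"
    using order_tendstoD(2)[OF h'_tendsto, of "K / 6"] K by simp
  then obtain s where "\<And>r. s \<le> r \<Longrightarrow> h' r < K / 6"
    by (auto simp: eventually_at_top_linorder)
  then have "late (max s (max t\<^sub>0 1))"
    by (force simp: late_def)
  then show ?thesis ..
qed

lemma Y_increment_le:
  assumes "late t\<^sub>1" "t\<^sub>1 \<le> s" "s \<le> t" "\<And>r. s \<le> r \<Longrightarrow> r \<le> t \<Longrightarrow> sqrt (2 * Y r) \<le> R"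
  shows "Y t - Y s \<le> integral {s..t} (\<lambda>r. K / 3 * (h r * E r) - K * (h r * (norm (u' r))\<^sup>2) + R * (h r * norm (g r)))"
proof (rule Y_increment)
  show "(\<lambda>r. K / 3 * (h r * E r) - K * (h r * (norm (u' r))\<^sup>2) + R * (h r * norm (g r))) integrable_on {s..t}"
    using assms unfolding late_def
    by (intro integrable_add integrable_diff integrable_on_mult_right weighted_integrable weighted_source_integrable) auto
qed (use assms in \<open>auto simp: late_def\<close>)

lemma Z_increment_le:
  assumes x: "x \<in> argmin \<Phi>" and "late t\<^sub>1" "t\<^sub>1 \<le> s" "s \<le> t" and C: "C = C\<^sub>0 + norm (\<iota> x)"
  shows "Z x t - Z x s \<le> integral {s..t} (\<lambda>r. 3 / 2 * (h r * (norm (u' r))\<^sup>2) - h r * E r + (C * (h r * norm (g r)) - h'' r * C\<^sup>2 / 2))"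
proof (rule Z_increment[OF x])
  show "(\<lambda>r. 3 / 2 * (h r * (norm (u' r))\<^sup>2) - h r * E r + (C * (h r * norm (g r)) - h'' r * C\<^sup>2 / 2)) integrable_on {s..t}"
    using assms unfolding late_def
    by (intro integrable_add integrable_diff integrable_on_mult_right integrable_on_divide integrable_on_mult_left weighted_integrable weighted_source_integrable) auto
  show "norm (\<iota> (u r) - \<iota> x) \<le> C" if "s \<le> r" for r
    using assms that distance_bounded[of r x] by (auto simp: late_def)
qed (use assms in \<open>auto simp: late_def\<close>)

lemma Z_abs_le:
  assumes "late t\<^sub>1" "t\<^sub>1 \<le> t" and C: "C = C\<^sub>0 + norm (\<iota> x)"
  shows "\<bar>Z x t\<bar> \<le> C * sqrt (2 * Y t) + (p t\<^sub>1 + K) * C\<^sup>2 / 2"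
proof -
  have t: "t\<^sub>0 \<le> t" "1 \<le> t" "0 \<le> t" "t\<^sub>0 \<le> t\<^sub>1" "2 * h' t \<le> K / 3"
    using assms by (auto simp: late_def)
  have y: "norm (\<iota> (u t) - \<iota> x) \<le> C"
    using distance_bounded[OF t(2)] by (simp add: C)
  \<comment> \<open>\<open>p t\<close> lies between \<open>K\<close> and \<open>p t\<^sub>1\<close>,
    and \<open>h' t\<close> between 0 and \<open>K / 6\<close>.\<close>
  have "\<bar>p t - h' t\<bar> \<le> p t\<^sub>1 + K"
    using p_antimono[OF t(4) assms(2)] p_ge[OF t(1)] h'_nonneg[OF t(3)] t(5) K by linarith
  moreover have "(norm (\<iota> (u t) - \<iota> x))\<^sup>2 \<le> C\<^sup>2"
    using y by (intro power_mono) auto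
  ultimately have "\<bar>p t - h' t\<bar> * (1 / 2 * (norm (\<iota> (u t) - \<iota> x))\<^sup>2) \<le> (p t\<^sub>1 + K) * (1 / 2 * C\<^sup>2)"
    by (intro mult_mono) auto
  then show ?thesis
    using cross_term_le[OF y t(3)] abs_triangle_ineq[of "h t * ((\<iota> (u t) - \<iota> x) \<bullet> u' t)" "(p t - h' t) * (1 / 2 * (norm (\<iota> (u t) - \<iota> x))\<^sup>2)"]
    by (simp add: Z_def abs_mult)
qed

text \<open>\<open>C\<^sub>0\<close> comes without a sign; the norm bound at time 1 supplies
  it.\<close>

lemma bound_nonneg: "0 \<le> C\<^sub>0 + norm (\<iota> x)"
  by (rule order_trans[OF norm_ge_zero distance_bounded[OF order_refl]])

text \<open>Any one minimiser may be used in \<open>Z\<close>, since neither \<open>Y\<close> nor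
  the two integrands depend on it.\<close>

lemma weighted_bounds:
  assumes late: "late t\<^sub>1"
  obtains M where "\<And>t. t\<^sub>1 \<le> t \<Longrightarrow> Y t \<le> M" "\<And>t. t\<^sub>1 \<le> t \<Longrightarrow> integral {t\<^sub>1..t} (\<lambda>r. h r * E r) \<le> M"
    "\<And>t. t\<^sub>1 \<le> t \<Longrightarrow> integral {t\<^sub>1..t} (\<lambda>r. h r * (norm (u' r))\<^sup>2) \<le> M"
proof -
  obtain x where x: "x \<in> argmin \<Phi>"
    using argmin_nonempty by auto
  define C where "C = C\<^sub>0 + norm (\<iota> x)"
  have C: "0 \<le> C" using bound_nonneg by (simp add: C_def)
  have t1: "t\<^sub>0 \<le> t\<^sub>1" "0 \<le> t\<^sub>1" "1 \<le> t\<^sub>1"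
    using late by (auto simp: late_def)
  have h0: "0 \<le> h t" if "t\<^sub>1 \<le> t" for t
    using h_ge_1[of t] that t1 by simp
  have "\<exists>M. \<forall>t\<ge>t\<^sub>1. Y t \<le> M \<and> integral {t\<^sub>1..t} (\<lambda>r. h r * E r) \<le> M \<and> integral {t\<^sub>1..t} (\<lambda>r. h r * (norm (u' r))\<^sup>2) \<le> M"
  proof (rule coupled_inequalities_bounded[OF K C, where k = "\<lambda>r. h r * norm (g r)" and Z = "Z x"
        and m = "\<lambda>r. C * (h r * norm (g r)) - h'' r * C\<^sup>2 / 2"])
    show "continuous_on {t\<^sub>1..} Y"
      unfolding Y_def[abs_def] using t1
      by (intro continuous_intros continuous_on_subset[OF h_continuous(1)] continuous_on_subset[OF energy_continuous]) auto
    show "\<bar>Z x t\<bar> \<le> C * sqrt (2 * Y t) + (p t\<^sub>1 + K) * C\<^sup>2 / 2" if "t\<^sub>1 \<le> t" for t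
      using late that C_def by (rule Z_abs_le)
    show "integral {t\<^sub>1..t} (\<lambda>r. h r * norm (g r)) \<le> integral {0..} (\<lambda>r. h r * norm (g r))" for t
      using t1 by (intro weighted_source_integrable)
    show "integral {t\<^sub>1..t} (\<lambda>r. C * (h r * norm (g r)) - h'' r * C\<^sup>2 / 2)
      \<le> C * integral {0..} (\<lambda>r. h r * norm (g r)) + h' t\<^sub>1 * C\<^sup>2 / 2" if "t\<^sub>1 \<le> t" for t
      using C t1(2) that by (rule Z_remainder_integral_le)
    show "(\<lambda>r. C * (h r * norm (g r)) - h'' r * C\<^sup>2 / 2) integrable_on {s..t}" if "t\<^sub>1 \<le> s" for s t
      using that t1 by (intro integrable_diff integrable_on_mult_right integrable_on_divide integrable_on_mult_left weighted_integrable weighted_source_integrable) auto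
    show "Y t - Y s \<le> integral {s..t} (\<lambda>r. K / 3 * (h r * E r) - K * (h r * (norm (u' r))\<^sup>2) + R * (h r * norm (g r)))"
      if "t\<^sub>1 \<le> s" "s \<le> t" "\<And>r. s \<le> r \<Longrightarrow> r \<le> t \<Longrightarrow> sqrt (2 * Y r) \<le> R" for s t R
      using late that by (rule Y_increment_le)
    show "Z x t - Z x s \<le> integral {s..t} (\<lambda>r. 3 / 2 * (h r * (norm (u' r))\<^sup>2) - h r * E r + (C * (h r * norm (g r)) - h'' r * C\<^sup>2 / 2))"
      if "t\<^sub>1 \<le> s" "s \<le> t" for s t
      using x late that C_def by (rule Z_increment_le)
    show "(\<lambda>r. h r * E r) integrable_on {s..t}" "(\<lambda>r. h r * (norm (u' r))\<^sup>2) integrable_on {s..t}"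
      "(\<lambda>r. h r * norm (g r)) integrable_on {s..t}" if "t\<^sub>1 \<le> s" for s t
      using that t1 by (auto intro: weighted_integrable weighted_source_integrable)
  qed (use h0 Y_nonneg in auto)
  then show ?thesis using that by blast
qed

section \<open>Decay of the energy and convergence of the distances to minimisers\<close>

lemma Y_tendsto: "(Y \<longlongrightarrow> 0) at_top"
proof -
  obtain t\<^sub>1 where late: "late t\<^sub>1"
    using late_exists by blast
  obtain M where YM: "\<And>t. t\<^sub>1 \<le> t \<Longrightarrow> Y t \<le> M"
      and EM: "\<And>t. t\<^sub>1 \<le> t \<Longrightarrow> integral {t\<^sub>1..t} (\<lambda>r. h r * E r) \<le> M"
      and M: "\<And>t. t\<^sub>1 \<le> t \<Longrightarrow> integral {t\<^sub>1..t} (\<lambda>r. h r * (norm (u' r))\<^sup>2) \<le> M"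
    by (rule weighted_bounds[OF late]) blast
  have t1: "t\<^sub>0 \<le> t\<^sub>1" "0 \<le> t\<^sub>1" "1 \<le> t\<^sub>1"
    using late by (auto simp: late_def)
  have h0: "0 \<le> h t" if "t\<^sub>1 \<le> t" for t
    using h_ge_1[of t] that t1 by simp
  define R where "R = sqrt (2 * M)"
  have R: "sqrt (2 * Y t) \<le> R" if "t\<^sub>1 \<le> t" for t
    using YM[OF that] by (simp add: R_def)
  have R0: "0 \<le> R"
    by (rule order_trans[OF _ R[OF order_refl]]) (simp add: Y_nonneg)
  \<comment> \<open>\<open>R\<close> is now a bound valid at all late times, so after dropping the
    dissipation the majorant \<open>n\<close> is nonnegative with bounded integrals.\<close>
  define n where "n = (\<lambda>r. K / 3 * (h r * E r) + R * (h r * norm (g r)))"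
  have n: "(n has_integral (K / 3 * integral {s..t} (\<lambda>r. h r * E r) + R * integral {s..t} (\<lambda>r. h r * norm (g r)))) {s..t}"
    if "t\<^sub>1 \<le> s" for s t
    unfolding n_def using that t1
    by (intro has_integral_add has_integral_mult_right integrable_integral weighted_integrable weighted_source_integrable) auto
  have "\<exists>L. (Y \<longlongrightarrow> L) at_top"
  proof (rule increments_le_integral_tendsto[where n = n])
    fix s t assume st: "t\<^sub>1 \<le> s" "s \<le> t"
    have "Y t - Y s \<le> integral {s..t} (\<lambda>r. K / 3 * (h r * E r) - K * (h r * (norm (u' r))\<^sup>2) + R * (h r * norm (g r)))"
      using late st R by (intro Y_increment_le) auto
    also have "\<dots> \<le> integral {s..t} n"
    proof (rule integral_le)
      show "(\<lambda>r. K / 3 * (h r * E r) - K * (h r * (norm (u' r))\<^sup>2) + R * (h r * norm (g r))) integrable_on {s..t}"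
        using t1 st by (intro integrable_add integrable_diff integrable_on_mult_right weighted_integrable weighted_source_integrable) auto
      show "n integrable_on {s..t}"
        using n[OF st(1)] by (rule has_integral_integrable)
      show "K / 3 * (h r * E r) - K * (h r * (norm (u' r))\<^sup>2) + R * (h r * norm (g r)) \<le> n r" if "r \<in> {s..t}" for r
        using h0[of r] K that st by (simp add: n_def)
    qed
    finally show "Y t - Y s \<le> integral {s..t} n" .
  next
    show "n integrable_on {s..t}" if "t\<^sub>1 \<le> s" for s t
      using n[OF that] by (rule has_integral_integrable)
    show "0 \<le> n t" if "t\<^sub>1 \<le> t" for t
      using h0[OF that] K R0 energy_nonneg[of t] by (simp add: n_def)
    show "integral {t\<^sub>1..t} n \<le> K / 3 * M + R * integral {0..} (\<lambda>r. h r * norm (g r))" if "t\<^sub>1 \<le> t" for t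
    proof -
      have "K / 3 * integral {t\<^sub>1..t} (\<lambda>r. h r * E r) \<le> K / 3 * M"
        using EM[OF that] K by (intro mult_left_mono) auto
      moreover have "R * integral {t\<^sub>1..t} (\<lambda>r. h r * norm (g r)) \<le> R * integral {0..} (\<lambda>r. h r * norm (g r))"
        using weighted_source_integrable(2)[OF t1(2)] R0 by (intro mult_left_mono) auto
      ultimately show ?thesis
        using n[of t\<^sub>1 t] by (simp add: integral_unique)
    qed
  qed (rule Y_nonneg)
  then obtain L where L: "(Y \<longlongrightarrow> L) at_top" by blast
  have "L = 0"
  proof (rule tendsto_zero_of_integral_div_bounded[OF L t1(2) _ _ _ EM])
    \<comment> \<open>\<open>Y / h\<close> is \<open>h E\<close>, and \<open>h t \<le> 1 + t\<close>
      because the exponent is at most 1.\<close>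
    show "Y t / (1 + t) \<le> h t * E t" if "t\<^sub>1 \<le> t" for t
    proof -
      have "(h t * h t) * E t \<le> (h t * (1 + t)) * E t"
        using h_le[of t] h0[OF that] that t1 energy_nonneg by (intro mult_right_mono mult_left_mono) auto
      then show ?thesis
        using that t1 by (simp add: Y_def power2_eq_square field_simps)
    qed
  qed (use t1 Y_nonneg in \<open>auto intro: weighted_integrable\<close>)
  with L show ?thesis by simp
qed

lemma distance_tendsto:
  assumes x: "x \<in> argmin \<Phi>"
  shows "\<exists>L. ((\<lambda>t. (norm (\<iota> (u t) - \<iota> x))\<^sup>2) \<longlongrightarrow> L) at_top"
proof -
  obtain t\<^sub>1 where late: "late t\<^sub>1"
    using late_exists by blast
  obtain M where YM: "\<And>t. t\<^sub>1 \<le> t \<Longrightarrow> Y t \<le> M"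
      and EM: "\<And>t. t\<^sub>1 \<le> t \<Longrightarrow> integral {t\<^sub>1..t} (\<lambda>r. h r * E r) \<le> M"
      and M: "\<And>t. t\<^sub>1 \<le> t \<Longrightarrow> integral {t\<^sub>1..t} (\<lambda>r. h r * (norm (u' r))\<^sup>2) \<le> M"
    by (rule weighted_bounds[OF late]) blast
  have t1: "t\<^sub>0 \<le> t\<^sub>1" "0 \<le> t\<^sub>1" "1 \<le> t\<^sub>1"
    using late by (auto simp: late_def)
  have h0: "0 \<le> h t" if "t\<^sub>1 \<le> t" for t
    using h_ge_1[of t] that t1 by simp
  define C where "C = C\<^sub>0 + norm (\<iota> x)"
  have C: "0 \<le> C" using bound_nonneg by (simp add: C_def)
  have yC: "norm (\<iota> (u t) - \<iota> x) \<le> C" if "t\<^sub>1 \<le> t" for t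
    using distance_bounded[of t x] that t1 by (simp add: C_def)
  define m where "m = (\<lambda>r. C * (h r * norm (g r)) - h'' r * C\<^sup>2 / 2)"
  have m: "m integrable_on {s..t}" if "t\<^sub>1 \<le> s" for s t
    unfolding m_def using that t1
    by (intro integrable_diff integrable_on_mult_right integrable_on_divide integrable_on_mult_left weighted_integrable weighted_source_integrable) auto
  \<comment> \<open>Now \<open>h E\<close> is the term that gets dropped, and the integral bound for
    \<open>h |u'|^2\<close> is the one that counts.\<close>
  define n where "n = (\<lambda>r. 3 / 2 * (h r * (norm (u' r))\<^sup>2) + m r)"
  have n: "(n has_integral (3 / 2 * integral {s..t} (\<lambda>r. h r * (norm (u' r))\<^sup>2) + integral {s..t} m)) {s..t}"
    if "t\<^sub>1 \<le> s" for s t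
    unfolding n_def using that t1
    by (intro has_integral_add has_integral_mult_right integrable_integral weighted_integrable m) auto
  have "\<exists>L. (Z x \<longlongrightarrow> L) at_top"
  proof (rule increments_le_integral_tendsto[where n = n])
    fix s t assume st: "t\<^sub>1 \<le> s" "s \<le> t"
    have "Z x t - Z x s \<le> integral {s..t} (\<lambda>r. 3 / 2 * (h r * (norm (u' r))\<^sup>2) - h r * E r + m r)"
      unfolding m_def using x late st C_def by (rule Z_increment_le)
    also have "\<dots> \<le> integral {s..t} n"
    proof (rule integral_le)
      show "(\<lambda>r. 3 / 2 * (h r * (norm (u' r))\<^sup>2) - h r * E r + m r) integrable_on {s..t}"
        using t1 st by (intro integrable_add integrable_diff integrable_on_mult_right weighted_integrable m) auto
      show "n integrable_on {s..t}"
        using n[OF st(1)] by (rule has_integral_integrable)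
      show "3 / 2 * (h r * (norm (u' r))\<^sup>2) - h r * E r + m r \<le> n r" if "r \<in> {s..t}" for r
        using h0[of r] energy_nonneg[of r] that st by (simp add: n_def)
    qed
    finally show "Z x t - Z x s \<le> integral {s..t} n" .
  next
    show "n integrable_on {s..t}" if "t\<^sub>1 \<le> s" for s t
      using n[OF that] by (rule has_integral_integrable)
    show "0 \<le> n t" if "t\<^sub>1 \<le> t" for t
    proof -
      have "h'' t * C\<^sup>2 \<le> 0"
        using h''_nonpos[of t] that t1 by (intro mult_nonpos_nonneg) auto
      moreover have "0 \<le> 3 / 2 * (h t * (norm (u' t))\<^sup>2)" "0 \<le> C * (h t * norm (g t))"
        using h0[OF that] C by simp_all
      ultimately show ?thesis
        unfolding n_def m_def by linarith
    qed
    show "integral {t\<^sub>1..t} n \<le> 3 / 2 * M + (C * integral {0..} (\<lambda>r. h r * norm (g r)) + h' t\<^sub>1 * C\<^sup>2 / 2)" if "t\<^sub>1 \<le> t" for t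
      using n[of t\<^sub>1 t] M[OF that] Z_remainder_integral_le[OF C t1(2) that] by (simp add: integral_unique m_def)
    show "- (C * sqrt (2 * M) + (p t\<^sub>1 + K) * C\<^sup>2 / 2) \<le> Z x t" if "t\<^sub>1 \<le> t" for t
    proof -
      have "C * sqrt (2 * Y t) \<le> C * sqrt (2 * M)"
        using YM[OF that] C by (intro mult_left_mono) auto
      then show ?thesis
        using Z_abs_le[OF late that C_def] by linarith
    qed
  qed
  then obtain L where L: "(Z x \<longlongrightarrow> L) at_top" by blast
  \<comment> \<open>The decay \<open>Y \<longlongrightarrow> 0\<close>, beyond mere boundedness,
    removes the cross term of \<open>Z\<close>; the \<open>h'\<close> term vanishes because
    distances are bounded. Only the \<open>p\<close> term is left in the limit.\<close>
  have Y0: "((\<lambda>t. C * sqrt (2 * Y t)) \<longlongrightarrow> C * sqrt (2 * 0)) at_top"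
    by (intro tendsto_intros Y_tendsto)
  have 1: "((\<lambda>t. h t * ((\<iota> (u t) - \<iota> x) \<bullet> u' t)) \<longlongrightarrow> 0) at_top"
    by (rule Lim_null_comparison[OF _ Y0[simplified]])
      (use eventually_ge_at_top[of t\<^sub>1] in eventually_elim, use cross_term_le yC t1 in auto)
  have h'0: "((\<lambda>t. h' t * (1 / 2 * C\<^sup>2)) \<longlongrightarrow> 0 * (1 / 2 * C\<^sup>2)) at_top"
    by (intro tendsto_intros h'_tendsto)
  have 2: "((\<lambda>t. h' t * (1 / 2 * (norm (\<iota> (u t) - \<iota> x))\<^sup>2)) \<longlongrightarrow> 0) at_top"
  proof (rule Lim_null_comparison[OF _ h'0[simplified]])
    show "\<forall>\<^sub>F t in at_top. norm (h' t * (1 / 2 * (norm (\<iota> (u t) - \<iota> x))\<^sup>2)) \<le> h' t * C\<^sup>2 / 2"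
      using eventually_ge_at_top[of t\<^sub>1]
    proof eventually_elim
      case (elim t)
      have "(norm (\<iota> (u t) - \<iota> x))\<^sup>2 \<le> C\<^sup>2"
        using yC[OF elim] by (intro power_mono) auto
      then show ?case
        using h'_nonneg[of t] elim t1 by (simp add: mult_left_mono)
    qed
  qed
  have "((\<lambda>t. Z x t - h t * ((\<iota> (u t) - \<iota> x) \<bullet> u' t) + h' t * (1 / 2 * (norm (\<iota> (u t) - \<iota> x))\<^sup>2)) \<longlongrightarrow> L - 0 + 0) at_top"
    by (intro tendsto_intros L 1 2)
  then have 3: "((\<lambda>t. p t * (1 / 2 * (norm (\<iota> (u t) - \<iota> x))\<^sup>2)) \<longlongrightarrow> L) at_top"
    by (simp add: Z_def algebra_simps diff_divide_distrib)
  \<comment> \<open>Convergence of \<open>p\<close> follows from monotonicity; its limit is at least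
    \<open>K > 0\<close>, so \<open>p\<close> can be divided out.\<close>
  have "\<exists>P. (p \<longlongrightarrow> P) at_top"
    by (rule antimono_bounded_below_tendsto[of t\<^sub>0]) (auto intro: p_antimono p_ge)
  then obtain P where P: "(p \<longlongrightarrow> P) at_top" by blast
  have "K \<le> P"
    by (rule tendsto_lowerbound[OF P]) (auto intro: eventually_mono[OF eventually_ge_at_top[of t\<^sub>0]] p_ge)
  then have "((\<lambda>t. 2 * (p t * (1 / 2 * (norm (\<iota> (u t) - \<iota> x))\<^sup>2)) / p t) \<longlongrightarrow> 2 * L / P) at_top"
    using K by (intro tendsto_intros P 3) auto
  moreover have "\<forall>\<^sub>F t in at_top. 2 * (p t * (1 / 2 * (norm (\<iota> (u t) - \<iota> x))\<^sup>2)) / p t = (norm (\<iota> (u t) - \<iota> x))\<^sup>2"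
    using eventually_ge_at_top[of t\<^sub>0] by eventually_elim (use p_ge K in force)
  ultimately have "((\<lambda>t. (norm (\<iota> (u t) - \<iota> x))\<^sup>2) \<longlongrightarrow> 2 * L / P) at_top"
    by (rule Lim_transform_eventually)
  then show ?thesis ..
qed

section \<open>Weak convergence in \<open>V\<close> and the decay rate\<close>

lemma energy_tendsto: "(E \<longlongrightarrow> 0) at_top"
proof (rule tendsto_sandwich[OF _ _ tendsto_const Y_tendsto])
  show "\<forall>\<^sub>F t in at_top. E t \<le> Y t"
    using eventually_ge_at_top[of 0] by eventually_elim (rule energy_le_Y)
qed (simp add: energy_nonneg)

lemma potential_tendsto:
  assumes x: "x \<in> argmin \<Phi>"
  shows "((\<lambda>t. \<Phi> (u t)) \<longlongrightarrow> \<Phi> x) at_top"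
proof -
  have le: "\<Phi> (u t) - \<Phi> x \<le> E t" for t
    by (simp add: energy_eq[OF x])
  have "((\<lambda>t. \<Phi> (u t) - \<Phi> x) \<longlongrightarrow> 0) at_top"
    by (rule tendsto_sandwich[OF _ _ tendsto_const energy_tendsto]) (simp_all add: le argmin_le[OF x])
  then show ?thesis
    by (simp add: LIM_zero_iff)
qed

text \<open>Coercivity controls the \<open>V\<close> norm up to the \<open>H\<close> norm, which is
  bounded along the trajectory. The quadratic form of \<open>u t - x\<close> is at most twice the
  excess of the potential over its minimum, since the first-order term vanishes at the minimiser
  \<open>x\<close>.\<close>

lemma u_bounded_V: "\<exists>M. eventually (\<lambda>t. norm (u t) \<le> M) at_top"
proof -
  obtain x where x: "x \<in> argmin \<Phi>"
    using argmin_nonempty by auto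
  define C where "C = C\<^sub>0 + norm (\<iota> x)"
  \<comment> \<open>The 2 is twice the excess 1 that is tolerated in the potential.\<close>
  define B where "B = (2 + lam * C\<^sup>2) / \<mu>"
  have "\<forall>\<^sub>F t in at_top. \<Phi> (u t) < \<Phi> x + 1"
    by (rule order_tendstoD(2)[OF potential_tendsto[OF x]]) simp
  then have "\<forall>\<^sub>F t in at_top. norm (u t) \<le> norm x + sqrt B"
    using eventually_ge_at_top[of 1]
  proof eventually_elim
    case (elim t)
    have "(norm (\<iota> (u t - x)))\<^sup>2 \<le> C\<^sup>2"
      using distance_bounded[OF elim(2)] by (intro power_mono) (auto simp: C_def \<iota>.diff)
    then have "lam * (norm (\<iota> (u t - x)))\<^sup>2 \<le> lam * C\<^sup>2"
      using lambda by (rule mult_left_mono)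
    moreover have "A (u t - x) (u t - x) \<le> 2"
      using potential_above_tangent[of x "u t"] argmin_D_potential[OF x] elim(1) by simp
    ultimately have "\<mu> * (norm (u t - x))\<^sup>2 \<le> 2 + lam * C\<^sup>2"
      using A_coercive[of "u t - x"] by linarith
    then have "(norm (u t - x))\<^sup>2 \<le> B"
      using mu by (simp add: B_def field_simps)
    then have "norm (u t - x) \<le> sqrt B"
      by (rule real_le_rsqrt)
    then show ?case
      using norm_triangle_sub[of "u t" x] by linarith
  qed
  then show ?thesis ..
qed

text \<open>The tangent at \<open>v\<close> is a weakly continuous affine minorant of
  \<open>\<Phi>\<close>. Along \<open>G\<close> it tends to \<open>\<Phi> v\<close>, while
  \<open>\<Phi> (u t)\<close> tends to the minimum.\<close>

lemma weak_cluster_point_in_argmin: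
  assumes G: "G \<le> at_top" "G \<noteq> bot" "weakly_tendsto u v G"
  shows "v \<in> argmin \<Phi>"
proof -
  obtain x where x: "x \<in> argmin \<Phi>"
    using argmin_nonempty by auto
  have "((\<lambda>t. \<Phi> v + (D\<Phi> v (u t) - D\<Phi> v v)) \<longlongrightarrow> \<Phi> v + (D\<Phi> v v - D\<Phi> v v)) G"
    using G(3) unfolding weakly_tendsto_def by (intro tendsto_add tendsto_diff tendsto_const) auto
  moreover have "((\<lambda>t. \<Phi> (u t)) \<longlongrightarrow> \<Phi> x) G"
    by (rule tendsto_mono[OF G(1) potential_tendsto[OF x]])
  moreover have "\<Phi> v + (D\<Phi> v (u t) - D\<Phi> v v) \<le> \<Phi> (u t)" for t
    using potential_above_tangent[of v "u t"] A_positive[of "u t - v"] by (simp add: blinfun.diff_right[of "D\<Phi> v"])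
  ultimately have "\<Phi> v \<le> \<Phi> x"
    using tendsto_le[OF G(2)] by fastforce
  then show ?thesis
    using argmin_le[OF x] by (auto simp: argmin_def is_arg_min_def not_less intro: order_trans)
qed

lemma u_weakly_tendsto: "\<exists>v\<in>argmin \<Phi>. weakly_tendsto u v at_top"
proof -
  obtain M where "eventually (\<lambda>t. norm (u t) \<le> M) at_top"
    using u_bounded_V by blast
  then show ?thesis
    using embedding weak_cluster_point_in_argmin distance_tendsto
    by (intro opial_weakly_tendsto[of at_top u M \<iota>]) (auto simp: dense_embedding_def)
qed

lemma energy_smallo: "E \<in> o[at_top](\<lambda>t. t powr (- 2 * \<alpha>))"
proof (rule smalloI_tendsto)
  have "0 \<le> E t / t powr (- 2 * \<alpha>) \<and> E t / t powr (- 2 * \<alpha>) \<le> Y t" if t: "1 \<le> t" for t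
  proof -
    \<comment> \<open>The weight in \<open>Y\<close> is a power of \<open>1 + t\<close> and so
      dominates the same power of \<open>t\<close>; hence \<open>Y\<close> dominates the
      quotient.\<close>
    have "t powr \<alpha> \<le> h t"
      unfolding h_def using t alpha by (intro powr_mono2) auto
    then have "(t powr \<alpha>)\<^sup>2 * E t \<le> Y t"
      unfolding Y_def using energy_nonneg by (intro mult_right_mono power_mono) auto
    moreover have "E t / t powr (- 2 * \<alpha>) = (t powr \<alpha>)\<^sup>2 * E t"
      using t by (simp add: powr_minus divide_inverse powr_add[symmetric] power2_eq_square)
    ultimately show ?thesis
      using energy_nonneg by simp
  qed
  then show "((\<lambda>t. E t / t powr (- 2 * \<alpha>)) \<longlongrightarrow> 0) at_top"
    by (intro tendsto_sandwich[OF _ _ tendsto_const Y_tendsto]) (auto intro: eventually_mono[OF eventually_ge_at_top[of 1]])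
  show "\<forall>\<^sub>F t in at_top. t powr (- 2 * \<alpha>) \<noteq> 0"
    using eventually_gt_at_top[of 0] by eventually_elim simp
qed

end

theorem theorem1p1:
  fixes \<iota> :: "'v::{real_inner, complete_space} \<Rightarrow> 'h::{real_inner, complete_space}"
    and \<alpha> K t\<^sub>0 lam \<mu> :: real
    and \<gamma> :: "real \<Rightarrow> real"
    and A f :: "'v \<Rightarrow> 'v \<Rightarrow>\<^sub>L real"
    and F :: "'v \<Rightarrow> real"
    and g :: "real \<Rightarrow> 'h"
    and u :: "real \<Rightarrow> 'v"
    and u' u'' :: "real \<Rightarrow> 'h"
  assumes embedding: "dense_embedding \<iota>"
    and alpha: "0 \<le> \<alpha>" "\<alpha> < 1"
    and gamma_W11: "W11_loc \<gamma>"
    and gamma_nonneg: "\<forall>t\<ge>0. 0 \<le> \<gamma> t"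
    and K: "0 < K"
    and t0: "0 \<le> t\<^sub>0"
    and gamma_lower: "\<forall>t\<ge>t\<^sub>0. K / (1 + t) powr \<alpha> \<le> \<gamma> t"
    and gamma_decr: "\<exists>d. W11_loc_deriv (\<lambda>t. (1 + t) powr \<alpha> * \<gamma> t) d \<and>
                         (AE t in lebesgue. t\<^sub>0 \<le> t \<longrightarrow> d t \<le> 0)"
    and A_linear: "bounded_linear A"
    and A_symmetric: "\<forall>v w. blinfun_apply (A v) w = blinfun_apply (A w) v"
    and A_positive: "\<forall>v. 0 \<le> blinfun_apply (A v) v"
    and lambda: "0 \<le> lam"
    and mu: "0 < \<mu>"
    and A_coercive: "\<forall>v. \<mu> * (norm v)\<^sup>2 \<le> blinfun_apply (A v) v + lam * (norm (\<iota> v))\<^sup>2"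
    and f_continuous: "continuous_on UNIV f"
    and F_convex: "convex_on UNIV F"
    and F_derivative: "\<forall>v. (F has_derivative blinfun_apply (f v)) (at v)"
    and argmin_nonempty: "argmin (potential A F) \<noteq> {}"
    and g_L1: "L1_on {0..} g"
    and g_weighted: "set_integrable lebesgue {0..} (\<lambda>t. (1 + t) powr \<alpha> * norm (g t))"
    and u_W21_H: "W11_loc_deriv (\<lambda>t. \<iota> (u t)) u'" "W11_loc_deriv u' u''"
    and u_W11_V: "W11_loc u"
    and equation: "AE t in lebesgue. 0 \<le> t \<longrightarrow>
                     to_dual \<iota> (u'' t) + \<gamma> t *\<^sub>R to_dual \<iota> (u' t) + A (u t) + f (u t)
                       = to_dual \<iota> (g t)"
    and u_bounded: "\<exists>C. AE t in lebesgue. 0 \<le> t \<longrightarrow> norm (\<iota> (u t)) \<le> C"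
  shows "(\<exists>v\<in>argmin (potential A F). weakly_tendsto u v at_top) \<and>
         energy (potential A F) u u' \<in> o[at_top](\<lambda>t. t powr (- 2 * \<alpha>))"
proof -
  obtain d where d: "W11_loc_deriv (\<lambda>t. (1 + t) powr \<alpha> * \<gamma> t) d" "AE t in lebesgue. t\<^sub>0 \<le> t \<longrightarrow> d t \<le> 0"
    using gamma_decr by blast
  obtain w where w: "W11_loc_deriv u w"
    using u_W11_V by (auto simp: W11_loc_def)
  obtain C where C: "AE t in lebesgue. 0 \<le> t \<longrightarrow> norm (\<iota> (u t)) \<le> C"
    using u_bounded by blast
  interpret damped_equation \<iota> \<alpha> K t\<^sub>0 lam \<mu> C \<gamma> d A f F g u w u' u''
    by (rule damped_equation.intro)
      (fact embedding alpha K t0 gamma_lower[rule_format] d A_linear A_symmetric[rule_format]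
        A_positive[rule_format] lambda mu A_coercive[rule_format] f_continuous F_convex
        F_derivative[rule_format] argmin_nonempty g_weighted u_W21_H w equation C)+
  show ?thesis
    using u_weakly_tendsto energy_smallo by blast
qed

end
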